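(* There exists an absolute constant $C>0$ such that the following bounds hold, each for all integers $n$ for which the left-hand side is defined: $$\Delta_{4,3}(n) \le C n^{-\frac43},\quad \Delta_{5,4}(n) \le C n^{-\frac32},\quad \Delta_{6,5}(n) \le C n^{-\frac{33}{20}},$$ $$\Delta_{7,6}(n) \le C n^{-1.676},\quad \Delta_{8,7}(n) \le C n^{-1.792},\quad \Delta_{9,8}(n) \le C n^{-\frac{19}{10}}.$$
   Context: For integers $2 \le k \le d+1$ and $n \ge k$, $\Delta_{k,d}(n)$ denotes the minimum $\Delta > 0$ such that among any $n$ (distinct) points in $[0,1]^d$ there are $k$ points which form a simplex with $(k-1)$-dimensional volume at most $\Delta$ (the simplex is the convex hull of the $k$ points; if it is degenerate its volume is $0$). *)

theory Defs
  imports "HOL-Analysis.Analysis"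
begin

text \<open>
  The \<open>m\<close>-dimensional volume of a subset \<open>S\<close> of an \<open>m\<close>-dimensional affine subspace
  \<open>p + span B\<close> is the Lebesgue measure of \<open>S\<close> in orthonormal coordinates on that subspace.
  It does not depend on \<open>p\<close> and \<open>B\<close>; if \<open>S\<close> lies in several such subspaces, then its volume is
  \<open>0\<close> in each of them. (The value is unspecified if \<open>S\<close> is not contained in any.)
\<close>

definition orthonormal_frame :: "(real^'d) set \<Rightarrow> bool" where
  "orthonormal_frame B \<longleftrightarrow> pairwise orthogonal B \<and> (\<forall>b\<in>B. norm b = 1)"

definition flat_volume_wrt :: "real^'d \<Rightarrow> (real^'d) set \<Rightarrow> (real^'d) set \<Rightarrow> real" where
  "flat_volume_wrt p B S =
     measure (\<Pi>\<^sub>M b\<in>B. lborel) {t \<in> extensional B. p + (\<Sum>b\<in>B. t b *\<^sub>R b) \<in> S}"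

definition flat_volume :: "nat \<Rightarrow> (real^'d) set \<Rightarrow> real" where
  "flat_volume m S = (THE v. \<exists>p B. orthonormal_frame B \<and> card B = m \<and> S \<subseteq> (+) p ` span B
                               \<and> v = flat_volume_wrt p B S)"

text \<open>
  \<open>heilbronn TYPE('d) k n\<close> is \<open>\<Delta>\<^sub>k\<^sub>,\<^sub>d(n)\<close> for \<open>d = CARD('d)\<close>, meant for \<open>2 \<le> k \<le> d + 1\<close> and
  \<open>k \<le> n\<close>; in that range the infimum below is attained. Points are distinct because \<open>P\<close> is a set of
  cardinality \<open>n\<close>.
\<close>

definition heilbronn :: "'d::finite itself \<Rightarrow> nat \<Rightarrow> nat \<Rightarrow> real" where
  "heilbronn _ k n = Inf {\<Delta>. \<Delta> > 0 \<and>
     (\<forall>P :: (real^'d) set. P \<subseteq> {x. \<forall>i. x $ i \<in> {0..1}} \<and> finite P \<and> card P = n \<longrightarrow>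
        (\<exists>Q\<subseteq>P. card Q = k \<and> flat_volume (k - 1) (convex hull Q) \<le> \<Delta>))}"

text \<open>In full dimension, the volume is the ordinary Lebesgue measure.\<close>

lemma orthonormal_coordinates_lborel:
  fixes B :: "'a::euclidean_space set" and g :: "'a \<Rightarrow> 'a"
  assumes g: "bij_betw g Basis B"
  shows "distr (\<Pi>\<^sub>M b\<in>B. lborel) borel (\<lambda>t. \<Sum>i\<in>Basis. t (g i) *\<^sub>R i) = (lborel :: 'a measure)"
proof (rule lborel_eqI[symmetric])
  have fB: "finite B" using g bij_betw_finite by fastforce
  have gB: "g i \<in> B" if "i \<in> Basis" for i using g that bij_betwE by blast
  have m [measurable]: "(\<lambda>t. \<Sum>i\<in>Basis. t (g i) *\<^sub>R i) \<in> (\<Pi>\<^sub>M b\<in>B. lborel) \<rightarrow>\<^sub>M (borel :: 'a measure)"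
    by (intro borel_measurable_sum borel_measurable_scaleR borel_measurable_const)
       (use gB measurable_component_singleton[of _ B "\<lambda>_. lborel::real measure"] in
          \<open>auto cong: measurable_cong_sets\<close>)
  interpret product_sigma_finite "\<lambda>_::'a. lborel :: real measure" ..
  let ?j = "inv_into Basis g"
  have j: "?j b \<in> Basis" "g (?j b) = b" if "b \<in> B" for b
    using g that by (auto simp: bij_betw_def f_inv_into_f inv_into_into)
  have jg: "?j (g i) = i" if "i \<in> Basis" for i
    using g that by (auto simp: bij_betw_def)
  fix l u :: 'a assume le: "\<And>b. b \<in> Basis \<Longrightarrow> l \<bullet> b \<le> u \<bullet> b"
  have eq: "(\<lambda>t. \<Sum>i\<in>Basis. t (g i) *\<^sub>R i) -` box l u \<inter> space (\<Pi>\<^sub>M b\<in>B. lborel)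
      = (\<Pi>\<^sub>E b\<in>B. {l \<bullet> ?j b <..< u \<bullet> ?j b})" (is "?L = ?R")
  proof -
    have "t \<in> ?L \<longleftrightarrow> t \<in> extensional B \<and> (\<forall>i\<in>Basis. l \<bullet> i < t (g i) \<and> t (g i) < u \<bullet> i)" for t
      by (auto simp: space_PiM PiE_iff mem_box)
    moreover have "(\<forall>i\<in>Basis. l \<bullet> i < t (g i) \<and> t (g i) < u \<bullet> i) \<longleftrightarrow>
        (\<forall>b\<in>B. l \<bullet> ?j b < t b \<and> t b < u \<bullet> ?j b)" for t
      using j jg gB by metis
    ultimately show ?thesis
      by (intro set_eqI) (simp only: PiE_iff greaterThanLessThan_iff, blast)
  qed
  have "emeasure (distr (\<Pi>\<^sub>M b\<in>B. lborel) borel (\<lambda>t. \<Sum>i\<in>Basis. t (g i) *\<^sub>R i)) (box l u)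
      = (\<Prod>b\<in>B. emeasure lborel {l \<bullet> ?j b <..< u \<bullet> ?j b})"
    by (subst emeasure_distr[OF m]) (simp_all only: eq emeasure_PiM fB, auto simp: emeasure_PiM fB)
  also have "\<dots> = (\<Prod>i\<in>Basis. emeasure lborel {l \<bullet> i <..< u \<bullet> i})"
    by (rule prod.reindex_bij_betw[OF g, symmetric, THEN trans]) (simp add: jg)
  also have "\<dots> = (\<Prod>i\<in>Basis. ennreal ((u - l) \<bullet> i))"
    by (intro prod.cong refl) (simp add: le inner_diff_left)
  also have "\<dots> = ennreal (\<Prod>i\<in>Basis. (u - l) \<bullet> i)"
    by (rule prod_ennreal) (simp add: le inner_diff_left)
  finally show "emeasure (distr (\<Pi>\<^sub>M b\<in>B. lborel) borel (\<lambda>t. \<Sum>i\<in>Basis. t (g i) *\<^sub>R i)) (box l u)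
      = (\<Prod>i\<in>Basis. (u - l) \<bullet> i)" .
qed simp

lemma flat_volume_wrt_full:
  fixes S B :: "(real^'d::{finite,wellorder}) set"
  assumes S: "compact S" and B: "orthonormal_frame B" "card B = CARD('d)"
  shows "flat_volume_wrt p B S = measure lborel S"
proof -
  have fB: "finite B" using B(2) card.infinite by fastforce
  obtain g where g: "bij_betw g (Basis :: (real, 'd) vec set) B"
    using finite_same_card_bij[of "Basis :: (real, 'd) vec set" B] fB B(2) by auto
  have gB: "g i \<in> B" if "i \<in> Basis" for i using g that bij_betwE by blast
  have gg: "g i \<bullet> g j = (if i = j then 1 else 0)" if "i \<in> Basis" "j \<in> Basis" for i j
  proof -
    have "g i = g j \<longleftrightarrow> i = j"
      using g that by (auto simp: bij_betw_def inj_on_eq_iff)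
    then show ?thesis
      using B(1) gB[OF that(1)] gB[OF that(2)]
      by (auto simp: orthonormal_frame_def pairwise_def orthogonal_def norm_eq_1)
  qed
  define h :: "(real, 'd) vec \<Rightarrow> (real, 'd) vec" where "h x = (\<Sum>i\<in>Basis. (x \<bullet> i) *\<^sub>R g i)" for x
  have lin: "linear h"
    unfolding h_def by (rule linearI) (simp_all add: inner_left_distrib scaleR_left_distrib sum.distrib scaleR_sum_right)
  have hin: "h x \<bullet> h y = x \<bullet> y" for x y
  proof -
    have "h x \<bullet> h y = (\<Sum>i\<in>Basis. \<Sum>j\<in>Basis. (x \<bullet> i) * ((y \<bullet> j) * (g i \<bullet> g j)))"
      unfolding h_def
      by (simp add: inner_sum_left inner_sum_right sum_distrib_left mult_ac) (rule sum.swap)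
    also have "\<dots> = (\<Sum>i\<in>Basis. \<Sum>j\<in>Basis. if i = j then (x \<bullet> i) * (y \<bullet> j) else 0)"
      by (intro sum.cong refl) (simp add: gg)
    also have "\<dots> = x \<bullet> y"
      by (simp add: euclidean_inner[of x y])
    finally show ?thesis .
  qed
  have orth: "orthogonal_transformation h"
    using lin hin by (simp add: orthogonal_transformation_def)
  then have bij: "bij h" by (rule orthogonal_transformation_bij)
  let ?T = "(\<lambda>x. -p + x) ` S"
  define A where "A = inv h ` ?T"
  have cT: "compact ?T" using S by (rule compact_translation)
  have orthi: "orthogonal_transformation (inv h)"
    using orth by (rule orthogonal_transformation_inv)
  have cA: "compact A"
    unfolding A_def
    by (rule compact_continuous_image[OF linear_continuous_on cT])
       (simp add: linear_conv_bounded_linear[symmetric] orthogonal_transformation_linear[OF orthi])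
  have bA: "A \<in> sets borel" using cA by (simp add: borel_compact)
  have lm: "compact X \<Longrightarrow> measure lebesgue X = measure lborel X" for X :: "(real, 'd) vec set"
    by (simp add: borel_compact)
  have "measure lborel A = measure lborel ?T"
    unfolding A_def using measure_orthogonal_image[OF orthi lmeasurable_compact[OF cT]]
    using cA cT lm A_def by simp
  also have "\<dots> = measure lborel S"
    using measure_translation[of "-p" S] lm[OF S] lm[OF cT] by simp
  finally have mA: "measure lborel A = measure lborel S" .
  have memA: "x \<in> A \<longleftrightarrow> p + h x \<in> S" for x
  proof -
    have "x \<in> A \<longleftrightarrow> h x \<in> ?T"
      unfolding A_def image_iff[of x] bij_inv_eq_iff[OF bij] by auto
    also have "\<dots> \<longleftrightarrow> p + h x \<in> S" by (force simp: image_iff)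
    finally show ?thesis .
  qed
  let ?F = "\<lambda>t. \<Sum>i\<in>(Basis::(real, 'd) vec set). t (g i) *\<^sub>R i"
  have hF: "h (?F t) = (\<Sum>b\<in>B. t b *\<^sub>R b)" for t
    unfolding h_def using sum.reindex_bij_betw[OF g, of "\<lambda>b. t b *\<^sub>R b"] by simp
  have m: "?F \<in> (\<Pi>\<^sub>M b\<in>B. lborel) \<rightarrow>\<^sub>M borel"
    by (intro borel_measurable_sum borel_measurable_scaleR borel_measurable_const)
       (use gB measurable_component_singleton[of _ B "\<lambda>_. lborel::real measure"] in
          \<open>auto cong: measurable_cong_sets\<close>)
  have "{t \<in> extensional B. p + (\<Sum>b\<in>B. t b *\<^sub>R b) \<in> S} = ?F -` A \<inter> space (\<Pi>\<^sub>M b\<in>B. lborel)"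
    using memA hF by (auto simp: space_PiM PiE_iff extensional_def)
  then have "flat_volume_wrt p B S = measure (distr (\<Pi>\<^sub>M b\<in>B. lborel) borel ?F) A"
    unfolding flat_volume_wrt_def by (simp add: measure_distr[OF m bA])
  also have "\<dots> = measure lborel S"
    by (simp add: orthonormal_coordinates_lborel[OF g] mA)
  finally show ?thesis .
qed

lemma flat_volume_full:
  fixes S :: "(real^'d::{finite,wellorder}) set"
  assumes "compact S"
  shows "flat_volume CARD('d) S = measure lborel S"
proof -
  have "orthonormal_frame (Basis :: (real, 'd) vec set)" "card (Basis :: (real, 'd) vec set) = CARD('d)"
    by (auto simp: orthonormal_frame_def pairwise_def orthogonal_def inner_not_same_Basis)
  moreover have "S \<subseteq> (+) 0 ` span (Basis :: (real, 'd) vec set)" by simp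
  ultimately show ?thesis
    unfolding flat_volume_def using flat_volume_wrt_full[OF assms]
    by (intro the_equality) metis+
qed

end

theory Submission
  imports Defs
begin

text \<open>
  A simplex with vertices \<open>x\<^sub>0, \<dots>, x\<^sub>d\<close> in the cube has \<open>1 / d!\<close> times the volume of
  the parallelotope spanned by the vectors \<open>(1, x\<^sub>i)\<close> in dimension \<open>m = d + 1\<close>. So it is enough to find,
  among \<open>n\<close> vectors in the unit ball of an \<open>m\<close>-dimensional space, \<open>m\<close> vectors that span a small
  volume. This projective form of the problem is stable under projections: if \<open>k\<close> vectors have been
  selected whose \<open>k\<close>-dimensional volume is at most \<open>n powr (- f)\<close>, all other vectors can be projected
  to the orthogonal complement of their span, which has dimension \<open>m - k\<close>. If \<open>m - k\<close> vectors of
  volume at most \<open>n powr (- e)\<close> are found there, then the \<open>m\<close> vectors together have volume at most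
  \<open>n powr (- (f + e))\<close> (lemma \<open>small_volume_compose\<close>).

  The first \<open>k\<close> vectors are selected by the pigeonhole principle, in one of two ways. Up to scaling,
  vectors in dimension \<open>m\<close> are points of a bounded region of dimension \<open>m - 1\<close>. A cluster of \<open>k\<close>
  points at mutual distance \<open>n powr (- 1 / (m - 1))\<close> has \<open>k - 1\<close> small heights, which gives
  \<open>f = (k - 1) / (m - 1)\<close> (lemma \<open>small_volume_cluster\<close>). In particular \<open>e = 1\<close> for two vectors in the
  plane: among \<open>n\<close> lines through the origin, two make an angle of order \<open>1 / n\<close>. For larger \<open>k\<close> it is
  better to take \<open>r\<close> points from one cluster and two points from another cluster with nearly the
  same direction; the directions form a space of dimension \<open>m - 2\<close>, and this gives
  \<open>k = r + 2\<close> and \<open>f = r / (m - 1) + 1 / (m - 2)\<close> (lemma \<open>small_volume_two_clusters\<close>).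

  For \<open>d = 3\<close> and \<open>d = 4\<close> a cluster of \<open>d - 1\<close> points is followed by two vectors in the plane, for
  \<open>d = 5\<close> and \<open>d = 6\<close> so are \<open>d - 1\<close> points from two clusters. For \<open>d = 7\<close> and \<open>d = 8\<close> a cluster of
  \<open>d - 5\<close> points is followed by the six vectors in dimension 6 that are known from \<open>d = 5\<close>.
\<close>

section \<open>Volumes of parallelotopes\<close>

text \<open>
  The volume of the parallelotope spanned by a list, as base times height: each vector contributes
  its distance to the span of the vectors behind it. In this form an upper bound for the volume
  amounts to an order of the vectors and, for each of them, a nearby point in the span of the later
  ones.
\<close>

primrec parvol :: "'a::euclidean_space list \<Rightarrow> real" where
  "parvol [] = 1"
| "parvol (v # vs) = infdist v (span (set vs)) * parvol vs"

lemma parvol_nonneg: "0 \<le> parvol vs"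
  by (induction vs) (auto intro: mult_nonneg_nonneg infdist_nonneg)

lemma infdist_span_le:
  assumes "x \<in> span V"
  shows "infdist v (span V) \<le> norm (v - x)"
  using infdist_le[OF assms, of v] by (simp add: dist_norm)

lemma infdist_span_attained:
  fixes v :: "'a::euclidean_space"
  obtains x where "x \<in> span V" "infdist v (span V) = norm (v - x)"
proof -
  have "span V \<noteq> {}" using span_zero[of V] by blast
  then obtain x where "x \<in> span V" "infdist v (span V) = dist v x"
    using infdist_attains_inf[OF closed_span] by metis
  then show ?thesis using that by (simp add: dist_norm)
qed

lemma infdist_span_eq_0_iff:
  fixes v :: "'a::euclidean_space"
  shows "infdist v (span V) = 0 \<longleftrightarrow> v \<in> span V"
proof -
  have "span V \<noteq> {}" using span_zero[of V] by blast
  then show ?thesis using in_closed_iff_infdist_zero[OF closed_span] by blast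
qed

lemma parvol_eq_0I: "0 \<in> set vs \<Longrightarrow> parvol vs = 0"
  by (induction vs) (auto simp: infdist_span_eq_0_iff span_zero)

lemma infdist_span_scaleR:
  fixes v :: "'a::euclidean_space"
  shows "infdist (c *\<^sub>R v) (span V) = \<bar>c\<bar> * infdist v (span V)"
proof (cases "c = 0")
  case True
  then show ?thesis by (simp add: infdist_span_eq_0_iff span_zero)
next
  case False
  show ?thesis
  proof (rule antisym)
    obtain x where x: "x \<in> span V" "infdist v (span V) = norm (v - x)"
      by (rule infdist_span_attained)
    have "infdist (c *\<^sub>R v) (span V) \<le> norm (c *\<^sub>R v - c *\<^sub>R x)"
      by (intro infdist_span_le span_scale x)
    then show "infdist (c *\<^sub>R v) (span V) \<le> \<bar>c\<bar> * infdist v (span V)"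
      by (simp add: x flip: scaleR_diff_right)
  next
    obtain x where x: "x \<in> span V" "infdist (c *\<^sub>R v) (span V) = norm (c *\<^sub>R v - x)"
      by (rule infdist_span_attained)
    have "infdist v (span V) \<le> norm (v - (1 / c) *\<^sub>R x)"
      by (intro infdist_span_le span_scale x)
    moreover have "c *\<^sub>R v - x = c *\<^sub>R (v - (1 / c) *\<^sub>R x)"
      using False by (simp add: scaleR_diff_right)
    ultimately show "\<bar>c\<bar> * infdist v (span V) \<le> infdist (c *\<^sub>R v) (span V)"
      using x(2) by (simp add: mult_left_mono)
  qed
qed

lemma span_image_scaleR:
  fixes y :: "'i \<Rightarrow> 'a::real_vector"
  assumes "\<And>i. i \<in> I \<Longrightarrow> c i \<noteq> 0"
  shows "span ((\<lambda>i. c i *\<^sub>R y i) ` I) = span (y ` I)"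
proof (rule antisym; rule span_minimal[OF _ subspace_span])
  show "(\<lambda>i. c i *\<^sub>R y i) ` I \<subseteq> span (y ` I)"
    by (auto intro: span_scale span_base)
  show "y ` I \<subseteq> span ((\<lambda>i. c i *\<^sub>R y i) ` I)"
  proof
    fix x assume "x \<in> y ` I"
    then obtain i where i: "i \<in> I" "x = y i" by blast
    have "(1 / c i) *\<^sub>R (c i *\<^sub>R y i) \<in> span ((\<lambda>i. c i *\<^sub>R y i) ` I)"
      using i by (intro span_scale span_base) auto
    then show "x \<in> span ((\<lambda>i. c i *\<^sub>R y i) ` I)" using i assms by simp
  qed
qed

lemma parvol_scaleR:
  "parvol (map (\<lambda>i. c i *\<^sub>R y i) is) = (\<Prod>i\<leftarrow>is. \<bar>c i\<bar>) * parvol (map y is)"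
proof (cases "\<exists>i\<in>set is. c i = 0")
  case True
  then have "0 \<in> set (map (\<lambda>i. c i *\<^sub>R y i) is)" by (force simp: image_iff)
  moreover have "(\<Prod>i\<leftarrow>is. \<bar>c i\<bar>) = 0" using True by (force simp: prod_list_zero_iff)
  ultimately show ?thesis by (simp add: parvol_eq_0I)
next
  case False
  then show ?thesis
  proof (induction "is")
    case (Cons i "is")
    have "span ((\<lambda>i. c i *\<^sub>R y i) ` set is) = span (y ` set is)"
      using Cons.prems by (intro span_image_scaleR) auto
    then show ?case using Cons by (simp add: infdist_span_scaleR)
  qed simp
qed

lemma parvol_nonzero_imp_dim:
  "parvol vs \<noteq> 0 \<Longrightarrow> dim (span (set vs)) = length vs"
proof (induction vs)
  case (Cons v vs)
  then show ?case
    by (simp add: infdist_span_eq_0_iff dim_span dim_insert)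
qed simp

lemma parvol_le_power:
  assumes "\<And>v. v \<in> set vs \<Longrightarrow> norm v \<le> R" "0 \<le> R"
  shows "parvol vs \<le> R ^ length vs"
  using assms(1)
proof (induction vs)
  case (Cons v vs)
  have "infdist v (span (set vs)) \<le> R"
    using infdist_span_le[OF span_zero, of v "set vs"] Cons.prems by fastforce
  then show ?case
    using Cons assms(2) by (auto intro!: mult_mono parvol_nonneg)
qed simp

text \<open>
  Modulo the span of \<open>as\<close>, a vector and its image under \<open>P\<close> agree, so heights over a
  base that contains \<open>as\<close> can be computed after \<open>P\<close>. With \<open>P\<close> the orthogonal projection
  along the span this turns a volume in dimension \<open>m\<close> into a product of a volume of \<open>as\<close>
  and a volume in the orthogonal complement.
\<close>

lemma parvol_append_le:
  assumes P: "linear P" and diff: "\<And>v. v - P v \<in> span (set as)"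
  shows "parvol (vs @ as) \<le> parvol (map P vs) * parvol as"
proof (induction vs)
  case (Cons v vs)
  obtain x where x: "x \<in> span (set (map P vs))"
      "infdist (P v) (span (set (map P vs))) = norm (P v - x)"
    by (rule infdist_span_attained)
  obtain z where z: "z \<in> span (set vs)" "x = P z"
    using x(1) linear_span_image[OF P, of "set vs"] by auto
  have "z + ((v - P v) - (z - P z)) \<in> span (set (vs @ as))"
    using z(1) span_mono[of "set vs" "set (vs @ as)"] span_mono[of "set as" "set (vs @ as)"]
    by (intro span_add[OF _ span_diff]) (use diff in auto)
  then have "infdist v (span (set (vs @ as))) \<le> norm (v - (z + ((v - P v) - (z - P z))))"
    by (rule infdist_span_le)
  also have "\<dots> = infdist (P v) (span (set (map P vs)))"
    using x z by (simp add: algebra_simps)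
  finally show ?case
    using Cons by (auto simp: mult.assoc intro!: mult_mono parvol_nonneg infdist_nonneg)
qed simp

text \<open>
  Points near \<open>a\<close> are also near every subspace through \<open>a\<close>.
\<close>

lemma parvol_append_near_le:
  assumes "a \<in> set as" "\<And>x. x \<in> set xs \<Longrightarrow> norm (x - a) \<le> \<delta>" "0 \<le> \<delta>"
  shows "parvol (xs @ as) \<le> \<delta> ^ length xs * parvol as"
  using assms(2)
proof (induction xs)
  case (Cons x xs)
  have "infdist x (span (set (xs @ as))) \<le> norm (x - a)"
    by (rule infdist_span_le) (simp add: assms(1) span_base)
  then have "infdist x (span (set (xs @ as))) \<le> \<delta>" using Cons.prems[of x] by simp
  then show ?case
    using Cons assms(3) by (auto simp: mult.assoc intro!: mult_mono parvol_nonneg)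
qed simp

text \<open>
  The gain comes from \<open>b'\<close>, which is put in front: the span of the other vectors contains \<open>b\<close>
  and the direction \<open>w\<close> of \<open>a' - a\<close>, and \<open>b'\<close> lies on the line through \<open>b\<close> with the almost
  equal direction \<open>w'\<close>. Its height is thus the product of the small length \<open>c'\<close> and the small
  difference of the directions.
\<close>

lemma parvol_two_clusters_le:
  assumes u: "a' - a = c *\<^sub>R w" "b' - b = c' *\<^sub>R w'" and w: "norm (w' - w) \<le> \<epsilon>" and c': "\<bar>c'\<bar> \<le> \<delta>"
    and near: "norm (a' - a) \<le> \<delta>" "\<And>x. x \<in> set xs \<Longrightarrow> norm (x - a) \<le> \<delta>"
    and R: "norm a \<le> R" "norm b \<le> R"
  shows "parvol (b' # a' # xs @ [b, a]) \<le> \<delta> ^ (length xs + 2) * \<epsilon> * R ^ 2"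
proof -
  have \<delta>: "0 \<le> \<delta>" and \<epsilon>: "0 \<le> \<epsilon>" and R0: "0 \<le> R"
    using c' w R by (meson abs_ge_zero norm_ge_zero order_trans)+
  have "parvol ((a' # xs) @ [b, a]) \<le> \<delta> ^ length (a' # xs) * parvol [b, a]"
    using near \<delta> by (intro parvol_append_near_le[where a = a]) auto
  also have "\<dots> \<le> \<delta> ^ length (a' # xs) * R ^ 2"
    using parvol_le_power[of "[b, a]" R] R R0 \<delta>
    by (intro mult_left_mono) (auto simp: power2_eq_square)
  finally have rest: "parvol (a' # xs @ [b, a]) \<le> \<delta> ^ (length xs + 1) * R ^ 2" by simp
  show ?thesis
  proof (cases "c = 0")
    case True
    then have "a' \<in> span (set (xs @ [b, a]))" using u(1) by (simp add: span_base)
    then have "infdist a' (span (set (xs @ [b, a]))) = 0" using infdist_span_eq_0_iff by blast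
    then have "parvol (b' # a' # xs @ [b, a]) = 0"
      by (simp only: parvol.simps mult_zero_left mult_zero_right)
    moreover have "0 \<le> \<delta> ^ (length xs + 2) * \<epsilon> * R ^ 2" using \<delta> \<epsilon> by simp
    ultimately show ?thesis by (rule ord_eq_le_trans)
  next
    case False
    let ?V = "set (a' # xs @ [b, a])"
    have "(1 / c) *\<^sub>R (a' - a) \<in> span ?V" by (intro span_scale span_diff span_base) auto
    then have "w \<in> span ?V" using u(1) False by simp
    then have "b + c' *\<^sub>R w \<in> span ?V" by (intro span_add span_scale) (auto intro: span_base)
    then have "infdist b' (span ?V) \<le> norm (b' - (b + c' *\<^sub>R w))" by (rule infdist_span_le)
    also have "b' - (b + c' *\<^sub>R w) = c' *\<^sub>R (w' - w)" using u(2) by (simp add: algebra_simps)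
    also have "norm \<dots> \<le> \<delta> * \<epsilon>" using c' w \<delta> by (simp add: mult_mono)
    finally have "parvol (b' # a' # xs @ [b, a]) \<le> (\<delta> * \<epsilon>) * (\<delta> ^ (length xs + 1) * R ^ 2)"
      using rest \<delta> \<epsilon> by (subst parvol.simps(2)) (intro mult_mono parvol_nonneg; simp)
    then show ?thesis by (simp add: mult_ac)
  qed
qed

lemma prod_list_le_1:
  fixes f :: "'i \<Rightarrow> real"
  assumes "\<And>i. i \<in> set is \<Longrightarrow> 0 \<le> f i \<and> f i \<le> 1"
  shows "0 \<le> (\<Prod>i\<leftarrow>is. f i) \<and> (\<Prod>i\<leftarrow>is. f i) \<le> 1"
  using assms by (induction "is") (auto intro: mult_le_one)

lemma parvol_contract_le:
  assumes "\<And>i. i \<in> set is \<Longrightarrow> v i = c i *\<^sub>R y i" "\<And>i. i \<in> set is \<Longrightarrow> \<bar>c i\<bar> \<le> 1"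
  shows "parvol (map v is) \<le> parvol (map y is)"
proof -
  have "map v is = map (\<lambda>i. c i *\<^sub>R y i) is" using assms(1) by simp
  then have "parvol (map v is) = (\<Prod>i\<leftarrow>is. \<bar>c i\<bar>) * parvol (map y is)"
    by (simp only: parvol_scaleR)
  also have "\<dots> \<le> 1 * parvol (map y is)"
    using prod_list_le_1[of "is" "\<lambda>i. \<bar>c i\<bar>"] assms(2)
    by (intro mult_right_mono parvol_nonneg) auto
  finally show ?thesis by simp
qed

section \<open>The projective Heilbronn problem\<close>

text \<open>
  The Heilbronn problem in projective form: among any \<open>n\<close> vectors in the unit ball of an
  \<open>m\<close>-dimensional space there are \<open>k\<close> that span a volume of order \<open>n powr (- e)\<close>. The space is a
  subspace of a fixed ambient space, so that passing to a quotient does not change the type; vectors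
  are indexed, since distinct points may coincide after a projection.
\<close>

definition small_volume :: "'a::euclidean_space itself \<Rightarrow> nat \<Rightarrow> nat \<Rightarrow> real \<Rightarrow> bool" where
  "small_volume _ m k e \<longleftrightarrow> (\<exists>C>0. \<forall>(S::'a set) (I::nat set) v.
     subspace S \<longrightarrow> dim S = m \<longrightarrow> finite I \<longrightarrow> k \<le> card I \<longrightarrow>
     (\<forall>i\<in>I. v i \<in> S \<and> norm (v i) \<le> 1) \<longrightarrow>
     (\<exists>is. distinct is \<and> set is \<subseteq> I \<and> length is = k \<and>
           parvol (map v is) \<le> C * real (card I) powr (- e)))"

lemma obtain_distinct_list:
  assumes "k \<le> card I"
  obtains xs where "distinct xs" "set xs \<subseteq> I" "length xs = k"
proof -
  obtain J where J: "J \<subseteq> I" "card J = k" "finite J"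
    using obtain_subset_with_card_n[OF assms] by blast
  obtain xs where "set xs = J" "distinct xs" using finite_distinct_list[OF J(3)] by blast
  then show ?thesis using that[of xs] J distinct_card by fastforce
qed

lemma powr_neg_le_of_proportion:
  assumes n: "0 < n" "n \<le> A * N" and e: "0 \<le> e"
  shows "real N powr (- e) \<le> real A powr e * real n powr (- e)"
proof -
  have pos: "0 < A" "0 < N" using n by (auto intro: Nat.gr0I)
  have "real n \<le> real A * real N" using n(2) by (metis of_nat_le_iff of_nat_mult)
  then have "(real A * real N) powr (- e) \<le> real n powr (- e)"
    using n(1) e by (intro powr_mono2') auto
  then have "real A powr e * (real A powr (- e) * real N powr (- e)) \<le> real A powr e * real n powr (- e)"
    by (intro mult_left_mono) (auto simp: powr_mult)
  then show ?thesis using pos by (simp add: powr_minus field_simps)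
qed

text \<open>
  Vectors of norm at most 1 span a volume of at most 1, so any finite range of cardinalities can be
  absorbed into the constant.
\<close>

lemma small_volumeI:
  fixes e :: real
  assumes e: "0 \<le> e" and C: "0 < C" and k: "1 \<le> k"
  assumes *: "\<And>(S::'a::euclidean_space set) (I::nat set) v.
     subspace S \<Longrightarrow> dim S = m \<Longrightarrow> finite I \<Longrightarrow> n\<^sub>0 \<le> card I \<Longrightarrow> k \<le> card I \<Longrightarrow>
     (\<And>i. i \<in> I \<Longrightarrow> v i \<in> S) \<Longrightarrow> (\<And>i. i \<in> I \<Longrightarrow> norm (v i) \<le> 1) \<Longrightarrow>
     \<exists>is. distinct is \<and> set is \<subseteq> I \<and> length is = k \<and>
           parvol (map v is) \<le> C * real (card I) powr (- e)"
  shows "small_volume TYPE('a) m k e"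
  unfolding small_volume_def
proof (intro exI[of _ "max C (real n\<^sub>0 powr e + 1)"] conjI allI impI)
  show "0 < max C (real n\<^sub>0 powr e + 1)" using C by simp
  fix S :: "'a set" and I :: "nat set" and v
  assume S: "subspace S" "dim S = m" and I: "finite I" "k \<le> card I"
    and v: "\<forall>i\<in>I. v i \<in> S \<and> norm (v i) \<le> 1"
  show "\<exists>is. distinct is \<and> set is \<subseteq> I \<and> length is = k \<and>
      parvol (map v is) \<le> max C (real n\<^sub>0 powr e + 1) * real (card I) powr (- e)"
  proof (cases "n\<^sub>0 \<le> card I")
    case True
    then obtain "is" where "distinct is" "set is \<subseteq> I" "length is = k"
        "parvol (map v is) \<le> C * real (card I) powr (- e)"
      using *[OF S I(1) True I(2)] v by blast
    moreover have "C * real (card I) powr (- e)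
        \<le> max C (real n\<^sub>0 powr e + 1) * real (card I) powr (- e)"
      by (intro mult_right_mono) auto
    ultimately show ?thesis by fastforce
  next
    case False
    obtain xs where xs: "distinct xs" "set xs \<subseteq> I" "length xs = k"
      using obtain_distinct_list[OF I(2)] .
    have le1: "parvol (map v xs) \<le> 1"
      using parvol_le_power[of "map v xs" 1] v xs by force
    show ?thesis
    proof -
      have c: "card I \<noteq> 0" using I(2) k by simp
      have "1 \<le> real n\<^sub>0 powr e * real (card I) powr (- e)"
        using c False e by (simp add: powr_minus field_simps powr_mono2)
      also have "\<dots> \<le> max C (real n\<^sub>0 powr e + 1) * real (card I) powr (- e)"
        by (intro mult_right_mono) auto
      finally show ?thesis using le1 xs by fastforce
    qed
  qed
qed

section \<open>Selecting vectors in two stages\<close>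

lemma obtain_orthogonal_complement_projection:
  fixes A :: "'a::euclidean_space set"
  assumes "subspace A"
  obtains P where "linear P" "\<And>x. x - P x \<in> A" "\<And>a x. a \<in> A \<Longrightarrow> orthogonal a (P x)"
    "\<And>x. norm (P x) \<le> norm x"
proof -
  obtain B where B: "B \<subseteq> A" "pairwise orthogonal B" "span B = A"
    using orthonormal_basis_subspace[OF assms] by metis
  define P where "P x = x - (\<Sum>b\<in>B. (b \<bullet> x / (b \<bullet> b)) *\<^sub>R b)" for x
  have diff: "x - P x \<in> A" for x
    using assms B(1) unfolding P_def by (auto intro!: subspace_sum subspace_scale)
  have orth: "orthogonal a (P x)" if "a \<in> A" for a x
    unfolding P_def using Gram_Schmidt_step[OF B(2)] that B(3) by blast
  have "linear P"
    unfolding P_def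
    by (rule linearI) (simp_all add: inner_add_right add_divide_distrib scaleR_add_left sum.distrib
        scaleR_diff_right scaleR_sum_right)
  moreover have "norm (P x) \<le> norm x" for x
  proof -
    have "norm ((x - P x) + P x) ^ 2 = norm (x - P x) ^ 2 + norm (P x) ^ 2"
      by (intro norm_add_Pythagorean orth diff)
    then show ?thesis by (simp add: norm_le_square power2_norm_eq_inner[symmetric] del: power2_norm_eq_inner)
  qed
  ultimately show ?thesis using that diff orth by blast
qed

text \<open>
  After \<open>k\<close> vectors with small volume have been selected, all remaining vectors can be projected to
  the orthogonal complement of their span. The \<open>l\<close> vectors selected there complete the first \<open>k\<close>,
  and the exponents add up. The gain over a direct selection of \<open>k + l\<close> vectors is that the second
  selection is again made among almost \<open>n\<close> vectors, but in a space of lower dimension.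
\<close>

lemma small_volume_compose:
  fixes e f :: real
  assumes f: "small_volume TYPE('a::euclidean_space) m k f"
    and e: "small_volume TYPE('a) (m - k) l e" and l: "1 \<le> l" and e0: "0 \<le> e"
  shows "small_volume TYPE('a) m (k + l) (f + e)"
proof -
  obtain C1 where C1: "C1 > 0" "\<And>(S::'a set) (I::nat set) v. \<lbrakk>subspace S; dim S = m; finite I;
      k \<le> card I; \<forall>i\<in>I. v i \<in> S \<and> norm (v i) \<le> 1\<rbrakk> \<Longrightarrow>
      \<exists>is. distinct is \<and> set is \<subseteq> I \<and> length is = k \<and> parvol (map v is) \<le> C1 * real (card I) powr (- f)"
    using f unfolding small_volume_def by metis
  obtain C2 where C2: "C2 > 0" "\<And>(S::'a set) (I::nat set) v. \<lbrakk>subspace S; dim S = m - k; finite I;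
      l \<le> card I; \<forall>i\<in>I. v i \<in> S \<and> norm (v i) \<le> 1\<rbrakk> \<Longrightarrow>
      \<exists>is. distinct is \<and> set is \<subseteq> I \<and> length is = l \<and> parvol (map v is) \<le> C2 * real (card I) powr (- e)"
    using e unfolding small_volume_def by metis
  define C where "C = C1 * (C2 * real (k + 1) powr e)"
  have C: "C > 0" using C1(1) C2(1) by (simp add: C_def)
  show ?thesis
    unfolding small_volume_def
  proof (intro exI[of _ C] conjI allI impI C)
    fix S :: "'a set" and I :: "nat set" and v
    assume S: "subspace S" "dim S = m" and I: "finite I" "k + l \<le> card I"
      and v: "\<forall>i\<in>I. v i \<in> S \<and> norm (v i) \<le> 1"
    obtain as where as: "distinct as" "set as \<subseteq> I" "length as = k"
        "parvol (map v as) \<le> C1 * real (card I) powr (- f)"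
      using C1(2)[OF S I(1) _ v] I(2) by auto
    define I' where "I' = I - set as"
    have I': "finite I'" "card I' = card I - k"
      using I(1) as by (auto simp: I'_def card_Diff_subset distinct_card)
    then have l': "l \<le> card I'" using I(2) by simp
    have "\<exists>bs. distinct bs \<and> set bs \<subseteq> I' \<and> length bs = l \<and>
        parvol (map v (bs @ as)) \<le> C * real (card I) powr (- (f + e))"
    \<comment> \<open>Every completion of a degenerate selection has volume \<open>0\<close>. Otherwise the span has dimension exactly \<open>k\<close>, as needed for the dimension of the complement.\<close>
    proof (cases "parvol (map v as) = 0")
      case True
      obtain bs where bs: "distinct bs" "set bs \<subseteq> I'" "length bs = l"
        using obtain_distinct_list[OF l'] .
      have "parvol (map v (bs @ as)) \<le> 0"
        using parvol_append_le[of "\<lambda>x. x" "map v as" "map v bs"] True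
        by (simp add: span_zero linear_id[unfolded id_def])
      then show ?thesis using bs C
        by (metis order_trans less_imp_le mult_nonneg_nonneg powr_ge_zero)
    next
      case False
      define A where "A = span (set (map v as))"
      have A: "subspace A" "dim A = k"
        using parvol_nonzero_imp_dim[OF False] as by (auto simp: A_def)
      have AS: "A \<subseteq> S"
        unfolding A_def by (rule span_minimal[OF _ S(1)]) (use as(2) v in auto)
      define S' where "S' = {y \<in> S. \<forall>x\<in>A. orthogonal x y}"
      have S': "subspace S'" "dim S' = m - k"
        using dim_subspace_orthogonal_to_vectors[OF A(1) S(1) AS] A(2) S
        by (auto simp: S'_def subspace_def orthogonal_clauses)
      obtain P where P: "linear P" "\<And>x. x - P x \<in> A" "\<And>a x. a \<in> A \<Longrightarrow> orthogonal a (P x)"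
          "\<And>x. norm (P x) \<le> norm x"
        using obtain_orthogonal_complement_projection[OF A(1)] by metis
      have "P x \<in> S" if "x \<in> S" for x
        using subspace_diff[OF S(1) that, of "x - P x"] P(2)[of x] AS by auto
      then have v': "\<forall>i\<in>I'. P (v i) \<in> S' \<and> norm (P (v i)) \<le> 1"
        using v P(3) order_trans[OF P(4)] by (auto simp: S'_def I'_def)
      obtain bs where bs: "distinct bs" "set bs \<subseteq> I'" "length bs = l"
          "parvol (map (\<lambda>i. P (v i)) bs) \<le> C2 * real (card I') powr (- e)"
        using C2(2)[OF S' I'(1) l' v'] by blast
      have "card I = card I' + k" "1 \<le> card I'" using I' I(2) l l' by auto
      then have "real (card I') powr (- e) \<le> real (k + 1) powr e * real (card I) powr (- e)"
        using mult_le_mono2[of 1 "card I'" k]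
        by (intro powr_neg_le_of_proportion e0) (auto simp: algebra_simps)
      then have "parvol (map (\<lambda>i. P (v i)) bs)
          \<le> C2 * (real (k + 1) powr e * real (card I) powr (- e))"
        using bs(4) C2(1) by (meson mult_left_mono less_imp_le order_trans)
      then have "parvol (map (\<lambda>i. P (v i)) bs) * parvol (map v as)
          \<le> (C2 * (real (k + 1) powr e * real (card I) powr (- e))) * (C1 * real (card I) powr (- f))"
        using as(4) C2(1) by (intro mult_mono) (auto intro: parvol_nonneg)
      also have "\<dots> = C * real (card I) powr (- (f + e))"
        by (simp add: C_def mult_ac add.commute flip: powr_add)
      finally have "parvol (map v (bs @ as)) \<le> C * real (card I) powr (- (f + e))"
        using parvol_append_le[OF P(1), of "map v as" "map v bs"] P(2)
        by (simp add: A_def comp_def)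
      then show ?thesis using bs by blast
    qed
    then obtain bs where "distinct bs" "set bs \<subseteq> I'" "length bs = l"
        "parvol (map v (bs @ as)) \<le> C * real (card I) powr (- (f + e))" by blast
    then show "\<exists>is. distinct is \<and> set is \<subseteq> I \<and> length is = k + l \<and>
        parvol (map v is) \<le> C * real (card I) powr (- (f + e))"
      using as by (intro exI[of _ "bs @ as"]) (auto simp: I'_def)
  qed
qed

section \<open>Clusters of points\<close>

lemma norm_le_sum_abs_inner:
  fixes B :: "'a::euclidean_space set"
  assumes B: "pairwise orthogonal B" "\<And>b. b \<in> B \<Longrightarrow> norm b = 1" and x: "x \<in> span B"
  shows "norm x \<le> (\<Sum>b\<in>B. \<bar>x \<bullet> b\<bar>)"
proof -
  have "finite B" using B(1) pairwise_orthogonal_imp_finite by blast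
  then have "x = (\<Sum>b\<in>B. (x \<bullet> b) *\<^sub>R b)"
    using orthonormal_basis_expand[OF B(1) B(2) x] by simp
  then have "norm x \<le> (\<Sum>b\<in>B. norm ((x \<bullet> b) *\<^sub>R b))" by (metis norm_sum)
  then show ?thesis using B(2) by simp
qed

text \<open>
  Volumes scale with each vector separately, so vectors may be replaced by multiples on the affine
  hyperplane of height 1 over some \<open>b\<close>. With \<open>b\<close> chosen from an orthonormal basis such that the
  coordinate along \<open>b\<close> is the largest one, the multiples stay bounded and the scaling factors do
  not exceed the norms; some basis vector serves for a proportion \<open>1 / m\<close> of the vectors. This
  lowers the dimension of the configuration by one.
\<close>

lemma projective_chart:
  fixes v :: "'i \<Rightarrow> 'a::euclidean_space"
  assumes S: "subspace S" "dim S = m" "1 \<le> m" and I: "finite I" and v: "\<And>i. i \<in> I \<Longrightarrow> v i \<in> S"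
  shows "\<exists>b J y c. b \<in> S \<and> norm b = 1 \<and> J \<subseteq> I \<and> card I \<le> m * card J \<and>
    (\<forall>i\<in>J. y i \<in> S \<and> y i \<bullet> b = 1 \<and> norm (y i) \<le> real m \<and> v i = c i *\<^sub>R y i \<and> \<bar>c i\<bar> \<le> norm (v i))"
proof -
  obtain B where B: "B \<subseteq> S" "pairwise orthogonal B" "\<And>b. b \<in> B \<Longrightarrow> norm b = 1"
      "card B = m" "span B = S"
    using orthonormal_basis_subspace[OF S(1)] S(2) by metis
  have fB: "finite B" "B \<noteq> {}" using B(4) S(3) card.infinite by fastforce+
  have "\<exists>b\<in>B. \<forall>b'\<in>B. \<bar>x \<bullet> b'\<bar> \<le> \<bar>x \<bullet> b\<bar>" for x
  proof -
    have "Max ((\<lambda>b. \<bar>x \<bullet> b\<bar>) ` B) \<in> (\<lambda>b. \<bar>x \<bullet> b\<bar>) ` B" using fB by (intro Max_in) auto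
    then show ?thesis using fB(1) Max_ge[of "(\<lambda>b. \<bar>x \<bullet> b\<bar>) ` B"] by fastforce
  qed
  then obtain g where g: "\<And>x. g x \<in> B" "\<And>x b'. b' \<in> B \<Longrightarrow> \<bar>x \<bullet> b'\<bar> \<le> \<bar>x \<bullet> g x\<bar>" by metis
  have "(\<lambda>i. g (v i)) \<in> I \<rightarrow> B" using g by auto
  then obtain b where b: "b \<in> B"
      "card ((\<lambda>i. g (v i)) -` {b} \<inter> I) * card B \<ge> card I"
    using pigeonhole_card[OF _ I fB] by blast
  define J where "J = (\<lambda>i. g (v i)) -` {b} \<inter> I"
  define c where "c i = v i \<bullet> b" for i
  \<comment> \<open>The largest coordinate vanishes only for the zero vector, which is \<open>0\<close> times any point of the chart.\<close>
  define y where "y i = (if c i = 0 then b else (1 / c i) *\<^sub>R v i)" for i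
  have bb: "b \<bullet> b = 1" using B(3)[OF b(1)] by (simp add: norm_eq_1)
  have nv: "norm (v i) \<le> real m * \<bar>c i\<bar>" if "i \<in> J" for i
  proof -
    have "norm (v i) \<le> (\<Sum>b'\<in>B. \<bar>v i \<bullet> b'\<bar>)"
      using that v B by (intro norm_le_sum_abs_inner) (auto simp: J_def)
    also have "\<dots> \<le> (\<Sum>b'\<in>B. \<bar>c i\<bar>)"
      using that g(2)[of _ "v i"] by (intro sum_mono) (auto simp: J_def c_def)
    finally show ?thesis by (simp add: B(4))
  qed
  show ?thesis
  proof (intro exI[of _ b] exI[of _ J] exI[of _ y] exI[of _ c] conjI ballI)
    show "b \<in> S" "norm b = 1" using b(1) B by auto
    show "J \<subseteq> I" "card I \<le> m * card J" using b(2) B(4) by (auto simp: J_def mult.commute)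
    fix i assume i: "i \<in> J"
    show "y i \<in> S" using i v S(1) b(1) B(1) by (auto simp: y_def J_def subspace_scale)
    show "y i \<bullet> b = 1" by (auto simp: y_def bb c_def)
    show "norm (y i) \<le> real m"
      using nv[OF i] B(3)[OF b(1)] S(3) by (auto simp: y_def field_simps)
    show "v i = c i *\<^sub>R y i" using nv[OF i] by (auto simp: y_def)
    show "\<bar>c i\<bar> \<le> norm (v i)"
      unfolding c_def using Cauchy_Schwarz_ineq2[of "v i" b] B(3)[OF b(1)] by simp
  qed
qed

text \<open>
  Pigeonhole principle on a grid of \<open>N ^ t\<close> cells, where \<open>N\<close> is as large as possible subject to
  \<open>K * N ^ t \<le> n\<close>.
\<close>

lemma cluster_in_ball:
  fixes R :: real
  assumes t: "1 \<le> t" and R: "0 < R" and K: "1 \<le> K"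
  shows "\<exists>C>0. \<forall>(T::'a::euclidean_space set) (I::'i set) z.
     subspace T \<longrightarrow> dim T = t \<longrightarrow> finite I \<longrightarrow> K \<le> card I \<longrightarrow> (\<forall>i\<in>I. z i \<in> T \<and> norm (z i) < R) \<longrightarrow>
     (\<exists>J\<subseteq>I. card J = K \<and> (\<forall>i\<in>J. \<forall>j\<in>J. norm (z i - z j) \<le> C * real (card I) powr (- (1 / real t))))"
proof -
  define C where "C = real t * (4 * R) * real K powr (1 / real t)"
  show ?thesis
  proof (intro exI[of _ C] conjI allI impI)
    show "0 < C" using t R K by (simp add: C_def)
    fix T :: "'a set" and I :: "'i set" and z
    assume T: "subspace T" "dim T = t" and I: "finite I" "K \<le> card I"
      and zTR: "\<forall>i\<in>I. z i \<in> T \<and> norm (z i) < R"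
    have z: "z i \<in> T" "norm (z i) < R" if "i \<in> I" for i using zTR that by auto
    obtain B where B: "B \<subseteq> T" "pairwise orthogonal B" "\<And>b. b \<in> B \<Longrightarrow> norm b = 1"
        "card B = t" "span B = T"
      using orthonormal_basis_subspace[OF T(1)] T(2) by metis
    have fB: "finite B" using B(4) t card.infinite by fastforce
    define n where "n = card I"
    define s where "s = (real n / real K) powr (1 / real t)"
    define N where "N = nat \<lfloor>s\<rfloor>"
    have nK: "1 \<le> real n / real K" using I(2) K by (simp add: n_def)
    have s1: "1 \<le> s" unfolding s_def using nK by (intro ge_one_powr_ge_zero) auto
    have N: "1 \<le> N" "real N \<le> s" "s \<le> 2 * real N"
    proof -
      have "1 \<le> \<lfloor>s\<rfloor>" using s1 by (simp add: le_floor_iff)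
      then have "real N = of_int \<lfloor>s\<rfloor>" "1 \<le> N" unfolding N_def by (simp_all add: le_nat_iff)
      then show "1 \<le> N" "real N \<le> s" "s \<le> 2 * real N" using \<open>1 \<le> \<lfloor>s\<rfloor>\<close> by linarith+
    qed
    have "real N ^ t \<le> s ^ t" using N by (intro power_mono) auto
    also have "\<dots> = real n / real K"
      unfolding s_def using t K I(2) n_def by (subst powr_power) auto
    finally have NK: "N ^ t * K \<le> n"
      using K by (simp add: field_simps flip: of_nat_power of_nat_mult)
    define cell where "cell i = (\<lambda>b\<in>B. nat \<lfloor>real N * (z i \<bullet> b + R) / (2 * R)\<rfloor>)" for i
    have coord: "0 \<le> real N * (z i \<bullet> b + R) / (2 * R)" "real N * (z i \<bullet> b + R) / (2 * R) < real N"
      if "i \<in> I" "b \<in> B" for i b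
    proof -
      have "\<bar>z i \<bullet> b\<bar> < R"
        using Cauchy_Schwarz_ineq2[of "z i" b] z(2)[OF that(1)] B(3)[OF that(2)] by simp
      then have "0 < z i \<bullet> b + R" "z i \<bullet> b + R < 2 * R" by linarith+
      then show "0 \<le> real N * (z i \<bullet> b + R) / (2 * R)"
        "real N * (z i \<bullet> b + R) / (2 * R) < real N"
        using N(1) R by (auto simp: divide_less_eq)
    qed
    have "cell \<in> I \<rightarrow> (B \<rightarrow>\<^sub>E {..<N})"
      using coord N(1) by (auto simp: cell_def nat_less_iff floor_less_iff)
    moreover have "finite (B \<rightarrow>\<^sub>E {..<N})" "card (B \<rightarrow>\<^sub>E {..<N}) = N ^ t"
      using fB B(4) by (auto simp: finite_PiE card_PiE)
    moreover have "B \<rightarrow>\<^sub>E {..<N} \<noteq> {}" using N(1) by (auto simp: PiE_eq_empty_iff lessThan_empty_iff)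
    ultimately obtain c where c: "card (cell -` {c} \<inter> I) * N ^ t \<ge> n"
      using pigeonhole_card[of cell I "B \<rightarrow>\<^sub>E {..<N}"] I(1) n_def by auto
    have "K * N ^ t \<le> card (cell -` {c} \<inter> I) * N ^ t"
      by (rule order_trans[OF _ c]) (use NK in \<open>simp add: mult.commute\<close>)
    then have "K \<le> card (cell -` {c} \<inter> I)" using N(1) by simp
    then obtain J where J: "J \<subseteq> cell -` {c} \<inter> I" "card J = K"
      using obtain_subset_with_card_n by metis
    have "norm (z i - z j) \<le> C * real n powr (- (1 / real t))" if ij: "i \<in> J" "j \<in> J" for i j
    proof -
      have ijI: "i \<in> I" "j \<in> I" and ce: "cell i = cell j" using ij J(1) by auto
      have "\<bar>(z i - z j) \<bullet> b\<bar> \<le> 2 * R / real N" if b: "b \<in> B" for b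
      proof -
        have "nat \<lfloor>real N * (z i \<bullet> b + R) / (2 * R)\<rfloor> = nat \<lfloor>real N * (z j \<bullet> b + R) / (2 * R)\<rfloor>"
          using fun_cong[OF ce, of b] b by (simp add: cell_def)
        then have "\<lfloor>real N * (z i \<bullet> b + R) / (2 * R)\<rfloor> = \<lfloor>real N * (z j \<bullet> b + R) / (2 * R)\<rfloor>"
          using coord[OF ijI(1) b] coord[OF ijI(2) b] by (simp add: eq_nat_nat_iff)
        then have "\<bar>real N * (z i \<bullet> b + R) / (2 * R) - real N * (z j \<bullet> b + R) / (2 * R)\<bar> \<le> 1"
          by linarith
        also have "real N * (z i \<bullet> b + R) / (2 * R) - real N * (z j \<bullet> b + R) / (2 * R)
            = ((z i - z j) \<bullet> b) * (real N / (2 * R))"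
          using R by (simp add: inner_diff_left field_simps)
        finally show ?thesis using N(1) R by (simp add: abs_mult field_simps)
      qed
      moreover have "z i - z j \<in> span B" using z(1) ijI B(5) T(1) by (simp add: subspace_diff)
      ultimately have "norm (z i - z j) \<le> real t * (2 * R / real N)"
        using norm_le_sum_abs_inner[OF B(2,3), of "z i - z j"]
          sum_bounded_above[of B "\<lambda>b. \<bar>(z i - z j) \<bullet> b\<bar>" "2 * R / real N"] B(4) by simp
      also have "\<dots> \<le> real t * (4 * R / s)"
        using N R s1 by (intro mult_left_mono) (auto simp: field_simps)
      also have "\<dots> = C * real n powr (- (1 / real t))"
        using K nK by (simp add: C_def s_def powr_divide powr_minus field_simps)
      finally show ?thesis .
    qed
    then show "\<exists>J\<subseteq>I. card J = K \<and> (\<forall>i\<in>J. \<forall>j\<in>J. norm (z i - z j) \<le> C * real (card I) powr (- (1 / real t)))"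
      using J by (intro exI[of _ J]) (auto simp: n_def)
  qed
qed

text \<open>
  The chart of height 1 over \<open>b\<close> is a translate of this complement, where the dimension drops by one.
\<close>

lemma unit_vector_orthogonal_complement:
  fixes S :: "'a::euclidean_space set"
  assumes "subspace S" "b \<in> S" "norm b = 1"
  shows "subspace {x \<in> S. orthogonal b x}" "dim {x \<in> S. orthogonal b x} = dim S - 1"
proof -
  show "subspace {x \<in> S. orthogonal b x}"
    using assms(1) by (auto simp: subspace_def orthogonal_clauses)
  have "{y \<in> S. \<forall>x\<in>span {b}. orthogonal x y} = {x \<in> S. orthogonal b x}"
    by (auto simp: span_singleton orthogonal_def dest: spec[of _ 1])
  then have "dim {x \<in> S. orthogonal b x} + dim (span {b}) = dim S"
    using dim_subspace_orthogonal_to_vectors[of "span {b}" S] assms by (simp add: span_minimal)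
  moreover have "dim (span {b}) = 1" using assms(3) by auto
  ultimately show "dim {x \<in> S. orthogonal b x} = dim S - 1" by simp
qed

lemma chart_minus_unit:
  fixes y :: "'i \<Rightarrow> 'a::euclidean_space"
  assumes S: "subspace S" and b: "b \<in> S" "norm b = 1"
    and y: "y i \<in> S" "y i \<bullet> b = 1" "norm (y i) \<le> real m"
  shows "y i - b \<in> {x \<in> S. orthogonal b x}" "norm (y i - b) < real m + 2"
proof -
  have "b \<bullet> b = 1" using b(2) by (simp add: norm_eq_1)
  then show "y i - b \<in> {x \<in> S. orthogonal b x}"
    using S b(1) y(1,2) by (simp add: subspace_diff orthogonal_def inner_diff_right inner_commute)
  show "norm (y i - b) < real m + 2"
    using norm_triangle_ineq4[of "y i" b] b(2) y(3) by linarith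
qed

text \<open>
  In a chart of dimension \<open>m - 1\<close> there are \<open>k\<close> points at mutual distance of order
  \<open>n powr (- 1 / (m - 1))\<close>, and all but one of them have a height of this order.
\<close>

lemma small_volume_cluster:
  assumes m: "2 \<le> m" and k: "1 \<le> k"
  shows "small_volume TYPE('a::euclidean_space) m k (real (k - 1) / real (m - 1))"
proof -
  define p where "p = 1 / real (m - 1)"
  have p: "0 \<le> p" by (simp add: p_def)
  have m1: "1 \<le> m" using m by simp
  have m': "1 \<le> m - 1" "0 < real m + 2" using m by auto
  obtain C where C: "0 < C" "\<forall>(T::'a set) (I::nat set) z.
     subspace T \<longrightarrow> dim T = m - 1 \<longrightarrow> finite I \<longrightarrow> k \<le> card I \<longrightarrow>
     (\<forall>i\<in>I. z i \<in> T \<and> norm (z i) < real m + 2) \<longrightarrow>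
     (\<exists>J\<subseteq>I. card J = k \<and> (\<forall>i\<in>J. \<forall>j\<in>J. norm (z i - z j) \<le> C * real (card I) powr (- p)))"
    using cluster_in_ball[where 'a='a and 'i=nat, OF m' k] unfolding p_def by blast
  define D where "D = C * real m powr p"
  have D: "0 < D" using C m by (simp add: D_def)
  show ?thesis
  proof (rule small_volumeI[where n\<^sub>0 = "m * k" and C = "D ^ (k - 1) * real m"])
    show "0 \<le> real (k - 1) / real (m - 1)" "0 < D ^ (k - 1) * real m" "1 \<le> k"
      using D m k by auto
    fix S :: "'a set" and I :: "nat set" and v
    assume S: "subspace S" "dim S = m" and I: "finite I" "m * k \<le> card I"
      and v: "\<And>i. i \<in> I \<Longrightarrow> v i \<in> S" "\<And>i. i \<in> I \<Longrightarrow> norm (v i) \<le> 1"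
    obtain b J y c where b: "b \<in> S" "norm b = 1" and J: "J \<subseteq> I" "card I \<le> m * card J"
      and yc: "\<forall>i\<in>J. y i \<in> S \<and> y i \<bullet> b = 1 \<and> norm (y i) \<le> real m \<and> v i = c i *\<^sub>R y i \<and> \<bar>c i\<bar> \<le> norm (v i)"
      using projective_chart[where v = v, OF S m1 I(1) v(1)] by blast
    have y: "y i \<in> S" "y i \<bullet> b = 1" "norm (y i) \<le> real m"
      and c: "v i = c i *\<^sub>R y i" "\<bar>c i\<bar> \<le> norm (v i)" if "i \<in> J" for i
      using yc that by blast+
    have c1: "\<bar>c i\<bar> \<le> 1" if "i \<in> J" for i
      using order_trans[OF c(2)[OF that] v(2)] that J(1) by blast
    define \<delta> where "\<delta> = D * real (card I) powr (- p)"
    have k': "k \<le> card J" using order_trans[OF I(2) J(2)] m by simp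
    have T: "subspace {x \<in> S. orthogonal b x}" "dim {x \<in> S. orthogonal b x} = m - 1"
      using unit_vector_orthogonal_complement[OF S(1) b] S(2) by simp_all
    have z: "\<forall>i\<in>J. y i - b \<in> {x \<in> S. orthogonal b x} \<and> norm (y i - b) < real m + 2"
      using chart_minus_unit[where y = y, OF S(1) b] y by blast
    obtain K where K: "K \<subseteq> J" "card K = k"
        "\<forall>i\<in>K. \<forall>j\<in>K. norm ((y i - b) - (y j - b)) \<le> C * real (card J) powr (- p)"
      using C(2)[rule_format, OF T finite_subset[OF J(1) I(1)] k', of "\<lambda>i. y i - b"] z by blast
    have "real (card J) powr (- p) \<le> real m powr p * real (card I) powr (- p)"
      using I(2) m k J(2) by (intro powr_neg_le_of_proportion p) (auto intro: Nat.gr0I)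
    then have "C * real (card J) powr (- p) \<le> \<delta>"
      using C(1) by (simp add: \<delta>_def D_def)
    moreover have "norm (y i - y j) \<le> C * real (card J) powr (- p)" if "i \<in> K" "j \<in> K" for i j
      using K(3) that by simp
    ultimately have close: "norm (y i - y j) \<le> \<delta>" if "i \<in> K" "j \<in> K" for i j
      using that order_trans by blast
    have \<delta>: "0 \<le> \<delta>" using D by (simp add: \<delta>_def)
    have fK: "finite K" "K \<noteq> {}" using K(2) k card.infinite by fastforce+
    obtain a where a: "a \<in> K" using fK by blast
    obtain xs where xs: "set xs = K - {a}" "distinct xs"
      using finite_distinct_list[of "K - {a}"] fK by auto
    have len: "length xs = k - 1" using distinct_card[OF xs(2)] xs(1) a fK K(2) by simp
    have "parvol (map v (xs @ [a])) \<le> parvol (map y (xs @ [a]))"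
      using xs a K(1) c(1) c1 by (intro parvol_contract_le[where c = c]) auto
    also have "\<dots> \<le> \<delta> ^ length (map y xs) * parvol [y a]"
      using parvol_append_near_le[of "y a" "[y a]" "map y xs" \<delta>] close a xs \<delta> by auto
    also have "\<dots> \<le> \<delta> ^ (k - 1) * real m"
      using len \<delta> y(3)[of a] a K(1) parvol_le_power[of "[y a]" "real m"]
      by (intro mult_mono parvol_nonneg) auto
    also have "\<delta> ^ (k - 1) = D ^ (k - 1) * real (card I) powr (- (real (k - 1) / real (m - 1)))"
    proof -
      have "0 < card I" using I(2) m k by (cases "card I") auto
      then show ?thesis
        by (simp add: \<delta>_def p_def power_mult_distrib powr_power)
    qed
    finally have "parvol (map v (xs @ [a]))
        \<le> D ^ (k - 1) * real m * real (card I) powr (- (real (k - 1) / real (m - 1)))"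
      by (simp add: mult_ac)
    then show "\<exists>is. distinct is \<and> set is \<subseteq> I \<and> length is = k \<and> parvol (map v is)
        \<le> D ^ (k - 1) * real m * real (card I) powr (- (real (k - 1) / real (m - 1)))"
      using xs len a K(1) J(1) k by (intro exI[of _ "xs @ [a]"]) auto
  qed
qed

section \<open>Two clusters with close directions\<close>

text \<open>
  If \<open>good\<close> sets occur in every subset of at least half the size, then a maximal disjoint family
  of them covers at least half of \<open>J\<close>.
\<close>

lemma obtain_many_disjoint_subsets:
  assumes J: "finite J" and r: "1 \<le> r"
    and good: "\<And>J'. J' \<subseteq> J \<Longrightarrow> card J \<le> 2 * card J' \<Longrightarrow> \<exists>D\<subseteq>J'. card D = r \<and> good D"
  obtains F where "finite F" "pairwise disjnt F" "\<And>D. D \<in> F \<Longrightarrow> D \<subseteq> J \<and> card D = r \<and> good D"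
    "card J \<le> 2 * r * card F"
proof -
  define FF where "FF = {F. F \<subseteq> {D. D \<subseteq> J \<and> card D = r \<and> good D} \<and> pairwise disjnt F}"
  have "FF \<subseteq> Pow (Pow J)" by (auto simp: FF_def)
  then have "finite FF" using J by (meson finite_Pow_iff finite_subset)
  moreover have "{} \<in> FF" by (simp add: FF_def)
  ultimately obtain F where F: "F \<in> FF" "\<And>G. G \<in> FF \<Longrightarrow> F \<subseteq> G \<Longrightarrow> F = G"
    using finite_has_maximal[of FF] by blast
  have sub: "D \<subseteq> J" "card D = r" "good D" if "D \<in> F" for D using F(1) that by (auto simp: FF_def)
  have fF: "finite F" using sub(1) J by (meson Pow_iff finite_Pow_iff finite_subset subsetI)
  have dj: "pairwise disjnt F" using F(1) by (simp add: FF_def)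
  have "card (\<Union>F) = sum card F"
    using dj sub(1) finite_subset[OF _ J] by (intro card_Union_disjoint) auto
  then have cU: "card (\<Union>F) = r * card F" using sub(2) by simp
  have "card J \<le> 2 * card (\<Union>F)"
  proof (rule ccontr)
    assume "\<not> card J \<le> 2 * card (\<Union>F)"
    moreover have "card (J - \<Union>F) = card J - card (\<Union>F)"
      using sub(1) J by (intro card_Diff_subset) (auto intro: finite_subset)
    ultimately have "card J \<le> 2 * card (J - \<Union>F)" by simp
    then obtain D where D: "D \<subseteq> J - \<Union>F" "card D = r" "good D" using good[of "J - \<Union>F"] by blast
    have "insert D F \<in> FF"
      using D F(1) by (auto simp: FF_def pairwise_insert disjnt_def)
    then have "D \<in> F" using F(2)[of "insert D F"] by blast
    then have "D = {}" using D(1) by blast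
    then show False using D(2) r by simp
  qed
  then show ?thesis using that[OF fF dj] sub cU by auto
qed

text \<open>
  A chart of dimension \<open>m - 1\<close> contains a number of order \<open>n\<close> of disjoint clusters of \<open>r\<close> points
  with diameter of order \<open>n powr (- 1 / (m - 1))\<close>. Each cluster has a direction, that of the
  difference of two of its points. Directions form a projective space of dimension \<open>m - 2\<close>, so two
  of the clusters have directions at distance of order \<open>n powr (- 1 / (m - 2))\<close>. All points of one
  of these clusters together with the two points that define the direction of the other are the
  \<open>r + 2\<close> vectors: of the \<open>r + 1\<close> heights other than that of the last vector, only the one that
  measures the distance between the clusters is not small.
\<close>

lemma small_volume_two_clusters:
  assumes m: "3 \<le> m" and r: "2 \<le> r"
  shows "small_volume TYPE('a::euclidean_space) m (r + 2) (real r / real (m - 1) + 1 / real (m - 2))"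
proof -
  define p where "p = 1 / real (m - 1)"
  define q where "q = 1 / real (m - 2)"
  have pq: "0 \<le> p" "0 \<le> q" by (simp_all add: p_def q_def)
  have m': "1 \<le> m" "1 \<le> m - 1" "1 \<le> m - 2" "0 < real m + 2" and r1: "1 \<le> r" and two: "1 \<le> (2::nat)"
    using m r by auto
  obtain C1 where C1: "0 < C1" "\<forall>(T::'a set) (I::nat set) z.
     subspace T \<longrightarrow> dim T = m - 1 \<longrightarrow> finite I \<longrightarrow> r \<le> card I \<longrightarrow>
     (\<forall>i\<in>I. z i \<in> T \<and> norm (z i) < real m + 2) \<longrightarrow>
     (\<exists>J\<subseteq>I. card J = r \<and> (\<forall>i\<in>J. \<forall>j\<in>J. norm (z i - z j) \<le> C1 * real (card I) powr (- p)))"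
    using cluster_in_ball[where 'a='a and 'i=nat, OF m'(2,4) r1] unfolding p_def by blast
  obtain C2 where C2: "0 < C2" "\<forall>(T::'a set) (I::nat set set) z.
     subspace T \<longrightarrow> dim T = m - 2 \<longrightarrow> finite I \<longrightarrow> 2 \<le> card I \<longrightarrow>
     (\<forall>i\<in>I. z i \<in> T \<and> norm (z i) < real m + 2) \<longrightarrow>
     (\<exists>J\<subseteq>I. card J = 2 \<and> (\<forall>i\<in>J. \<forall>j\<in>J. norm (z i - z j) \<le> C2 * real (card I) powr (- q)))"
    using cluster_in_ball[where 'a='a and 'i="nat set", OF m'(3,4) two]
    unfolding q_def by metis
  define A where "A = 2 * r * m * m"
  have A: "0 < A" "2 * m \<le> A" 
    using m r mult_le_mono[of 1 "r * m" "2 * m" "2 * m"] by (auto simp: A_def mult_ac)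
  define D where "D = C1 * real (2 * m) powr p"
  define E where "E = C2 * real A powr q"
  have DE: "0 < D" "0 < E" using C1 C2 m A by (auto simp: D_def E_def)
  show ?thesis
  proof (rule small_volumeI[where n\<^sub>0 = "2 * A" and C = "D ^ r * E * real m ^ 2"])
    show "0 \<le> real r / real (m - 1) + 1 / real (m - 2)" "0 < D ^ r * E * real m ^ 2" "1 \<le> r + 2"
      using DE m by auto
    fix S :: "'a set" and I :: "nat set" and v
    assume S: "subspace S" "dim S = m" and I: "finite I" "2 * A \<le> card I"
      and v: "\<And>i. i \<in> I \<Longrightarrow> v i \<in> S" "\<And>i. i \<in> I \<Longrightarrow> norm (v i) \<le> 1"
    define n where "n = card I"
    have n: "0 < n" "2 * A \<le> n" using I(2) A by (auto simp: n_def)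
    obtain b J y c where b: "b \<in> S" "norm b = 1" and J: "J \<subseteq> I" "card I \<le> m * card J"
      and yc: "\<forall>i\<in>J. y i \<in> S \<and> y i \<bullet> b = 1 \<and> norm (y i) \<le> real m \<and> v i = c i *\<^sub>R y i \<and> \<bar>c i\<bar> \<le> norm (v i)"
      using projective_chart[where v = v, OF S m'(1) I(1) v(1)] by blast
    have y: "y i \<in> S" "y i \<bullet> b = 1" "norm (y i) \<le> real m"
      and c: "v i = c i *\<^sub>R y i" "\<bar>c i\<bar> \<le> norm (v i)" if "i \<in> J" for i
      using yc that by blast+
    have c1: "\<bar>c i\<bar> \<le> 1" if "i \<in> J" for i
      using order_trans[OF c(2)[OF that] v(2)] that J(1) by blast
    have fJ: "finite J" using J(1) I(1) finite_subset by blast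
    define T where "T = {x \<in> S. orthogonal b x}"
    have T: "subspace T" "dim T = m - 1"
      using unit_vector_orthogonal_complement[OF S(1) b] S(2) by (simp_all add: T_def)
    define \<delta> where "\<delta> = D * real n powr (- p)"
    define good where "good K \<longleftrightarrow> (\<forall>i\<in>K. \<forall>j\<in>K. norm (y i - y j) \<le> \<delta>)" for K
    have "\<exists>K\<subseteq>J'. card K = r \<and> good K" if J': "J' \<subseteq> J" "card J \<le> 2 * card J'" for J'
    proof -
      have nJ: "n \<le> 2 * m * card J'"
        using order_trans[OF J(2) mult_le_mono2[OF J'(2), of m]] by (simp add: n_def mult_ac)
      have "2 * m * (2 * r) \<le> 2 * m * card J'"
      proof -
        have "2 * m * (2 * r) \<le> 2 * A" using m by (simp add: A_def)
        then show ?thesis using nJ n by linarith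
      qed
      then have r': "r \<le> card J'" using m by simp
      have yT: "\<forall>i\<in>J'. y i - b \<in> T \<and> norm (y i - b) < real m + 2"
        using chart_minus_unit[where y = y, OF S(1) b] y J'(1) unfolding T_def by blast
      obtain K where K: "K \<subseteq> J'" "card K = r"
          "\<forall>i\<in>K. \<forall>j\<in>K. norm ((y i - b) - (y j - b)) \<le> C1 * real (card J') powr (- p)"
        using C1(2)[rule_format, OF T finite_subset[OF J'(1) fJ] r', of "\<lambda>i. y i - b"] yT by blast
      have "real (card J') powr (- p) \<le> real (2 * m) powr p * real n powr (- p)"
        by (rule powr_neg_le_of_proportion[OF n(1) nJ pq(1)])
      then have le: "C1 * real (card J') powr (- p) \<le> \<delta>"
        using C1(1) by (simp add: \<delta>_def D_def)
      have "good K"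
        unfolding good_def
      proof (intro ballI)
        fix i j assume "i \<in> K" "j \<in> K"
        then have "norm (y i - y j) \<le> C1 * real (card J') powr (- p)" using K(3) by simp
        then show "norm (y i - y j) \<le> \<delta>" using le by (rule order_trans)
      qed
      then show ?thesis using K by blast
    qed
    then obtain F where F: "finite F" "pairwise disjnt F"
        "\<And>K. K \<in> F \<Longrightarrow> K \<subseteq> J \<and> card K = r \<and> good K" "card J \<le> 2 * r * card F"
      using obtain_many_disjoint_subsets[OF fJ r1, of good] by blast
    have "\<exists>i j. i \<in> K \<and> j \<in> K \<and> i \<noteq> j" if "K \<in> F" for K
    proof -
      have "\<not> card K \<le> Suc 0" using F(3)[OF that] r by simp
      moreover have "finite K" using F(3)[OF that] fJ finite_subset by blast
      ultimately show ?thesis using card_le_Suc0_iff_eq by blast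
    qed
    then obtain i j where ij: "\<And>K. K \<in> F \<Longrightarrow> i K \<in> K" "\<And>K. K \<in> F \<Longrightarrow> j K \<in> K"
        "\<And>K. K \<in> F \<Longrightarrow> i K \<noteq> j K" by metis
    define u where "u K = y (j K) - y (i K)" for K
    have uT: "u K \<in> T" if "K \<in> F" for K
    proof -
      have "i K \<in> J" "j K \<in> J" using F(3)[OF that] ij[OF that] by auto
      then show ?thesis
        using y S(1) by (simp add: u_def T_def subspace_diff orthogonal_def inner_diff_right inner_commute)
    qed
    \<comment> \<open>Directions are compared in a chart of the space \<open>T\<close> of differences; this is where the dimension drops to \<open>m - 2\<close>.\<close>
    obtain b' F' w c' where b': "b' \<in> T" "norm b' = 1" and F': "F' \<subseteq> F" "card F \<le> (m - 1) * card F'"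
      and wc': "\<forall>K\<in>F'. w K \<in> T \<and> w K \<bullet> b' = 1 \<and> norm (w K) \<le> real (m - 1) \<and>
        u K = c' K *\<^sub>R w K \<and> \<bar>c' K\<bar> \<le> norm (u K)"
      using projective_chart[where v = u, OF T m'(2) F(1) uT] by blast
    have w: "w K \<in> T" "w K \<bullet> b' = 1" "norm (w K) \<le> real (m - 1)"
      and c': "u K = c' K *\<^sub>R w K" "\<bar>c' K\<bar> \<le> norm (u K)" if "K \<in> F'" for K
      using wc' that by blast+
    define T' where "T' = {x \<in> T. orthogonal b' x}"
    have T': "subspace T'" "dim T' = m - 2"
      using unit_vector_orthogonal_complement[OF T(1) b'] T(2) by (simp_all add: T'_def)
    have nF': "n \<le> A * card F'"
    proof -
      have "n \<le> m * card J" using J(2) by (simp add: n_def)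
      also have "\<dots> \<le> m * (2 * r * card F)" using F(4) by (rule mult_le_mono2)
      also have "\<dots> \<le> m * (2 * r * (m * card F'))"
        using order_trans[OF F'(2), of "m * card F'"] by (intro mult_le_mono2) simp
      finally show ?thesis by (simp add: A_def mult_ac)
    qed
    have two': "2 \<le> card F'"
    proof -
      have "A * 2 \<le> A * card F'" using nF' n by linarith
      then show ?thesis using A by simp
    qed
    have wT: "\<forall>K\<in>F'. w K - b' \<in> T' \<and> norm (w K - b') < real m + 2"
    proof
      fix K assume K: "K \<in> F'"
      then have "norm (w K) \<le> real m" using w(3) by fastforce
      then show "w K - b' \<in> T' \<and> norm (w K - b') < real m + 2"
        using chart_minus_unit[where y = w, OF T(1) b'] w(1,2) K unfolding T'_def by blast
    qed
    obtain L where L: "L \<subseteq> F'" "card L = 2"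
        "\<forall>K\<in>L. \<forall>K'\<in>L. norm ((w K - b') - (w K' - b')) \<le> C2 * real (card F') powr (- q)"
      using C2(2)[rule_format, OF T' finite_subset[OF F'(1) F(1)] two', of "\<lambda>K. w K - b'"] wT by blast
    obtain K1 K2 where K12: "L = {K1, K2}" "K1 \<noteq> K2" using L(2) by (auto simp: card_2_iff)
    define \<epsilon> where "\<epsilon> = E * real n powr (- q)"
    have "real (card F') powr (- q) \<le> real A powr q * real n powr (- q)"
      by (rule powr_neg_le_of_proportion[OF n(1) nF' pq(2)])
    then have le: "C2 * real (card F') powr (- q) \<le> \<epsilon>"
      using C2(1) by (simp add: \<epsilon>_def E_def)
    have "norm (w K2 - w K1) \<le> C2 * real (card F') powr (- q)" using L(3) K12(1) by simp
    then have close: "norm (w K2 - w K1) \<le> \<epsilon>" using le by (rule order_trans)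
    have KF: "K1 \<in> F'" "K2 \<in> F'" "K1 \<in> F" "K2 \<in> F" using K12(1) L(1) F'(1) by auto
    have KJ: "K1 \<subseteq> J" "K2 \<subseteq> J" "card K1 = r" "good K1" "good K2" using F(3) KF by auto
    have dj: "K1 \<inter> K2 = {}" using F(2) KF(3,4) K12(2) by (auto simp: pairwise_def disjnt_def)
    have fK: "finite K1" using KJ(1) fJ finite_subset by blast
    obtain xs where xs: "set xs = K1 - {i K1, j K1}" "distinct xs"
      using finite_distinct_list[of "K1 - {i K1, j K1}"] fK by blast
    have len: "length xs + 2 = r"
    proof -
      have "length xs = card (K1 - {i K1, j K1})" using distinct_card[OF xs(2)] xs(1) by simp
      also have "\<dots> = card K1 - card {i K1, j K1}"
        using ij KF(3) by (intro card_Diff_subset) auto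
      finally show ?thesis using KJ(3) ij(3)[OF KF(3)] r by simp
    qed
    \<comment> \<open>The order asked for by the volume bound for two clusters.\<close>
    define js where "js = j K2 # j K1 # xs @ [i K2, i K1]"
    have js: "distinct js" "set js \<subseteq> J" "length js = r + 2"
      using xs ij[OF KF(3)] ij[OF KF(4)] dj KJ len by (auto simp: js_def)
    have "parvol (map v js) \<le> parvol (map y js)"
      using js(2) c(1) c1 by (intro parvol_contract_le[where c = c]) auto
    also have "map y js = y (j K2) # y (j K1) # map y xs @ [y (i K2), y (i K1)]"
      by (simp add: js_def)
    also have "parvol \<dots> \<le> \<delta> ^ (length (map y xs) + 2) * \<epsilon> * real m ^ 2"
    proof (rule parvol_two_clusters_le)
      show "y (j K1) - y (i K1) = c' K1 *\<^sub>R w K1" "y (j K2) - y (i K2) = c' K2 *\<^sub>R w K2"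
        using c'(1) KF by (simp_all flip: u_def)
      show "norm (w K2 - w K1) \<le> \<epsilon>" by (fact close)
      have "norm (u K2) \<le> \<delta>" using KJ(5) ij KF(4) by (simp add: u_def good_def)
      then show "\<bar>c' K2\<bar> \<le> \<delta>" using c'(2)[OF KF(2)] by simp
      show "norm (y (j K1) - y (i K1)) \<le> \<delta>" using KJ(4) ij KF(3) by (simp add: good_def)
      show "norm (x - y (i K1)) \<le> \<delta>" if "x \<in> set (map y xs)" for x
        using KJ(4) ij(1)[OF KF(3)] that xs(1) by (auto simp: good_def)
      show "norm (y (i K1)) \<le> real m" "norm (y (i K2)) \<le> real m"
        using y(3) ij(1) KF KJ by auto
    qed
    also have "\<delta> ^ (length (map y xs) + 2) = D ^ r * real n powr (- (real r / real (m - 1)))"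
      using len n(1) by (simp add: \<delta>_def p_def power_mult_distrib powr_power)
    also have "(D ^ r * real n powr (- (real r / real (m - 1)))) * \<epsilon> * real m ^ 2
        = D ^ r * E * real m ^ 2 * (real n powr (- (real r / real (m - 1))) * real n powr (- q))"
      by (simp add: \<epsilon>_def mult_ac)
    also have "\<dots> = D ^ r * E * real m ^ 2 * real n powr (- (real r / real (m - 1) + 1 / real (m - 2)))"
      by (simp add: q_def flip: powr_add)
    finally show "\<exists>is. distinct is \<and> set is \<subseteq> I \<and> length is = r + 2 \<and> parvol (map v is)
        \<le> D ^ r * E * real m ^ 2 * real (card I) powr (- (real r / real (m - 1) + 1 / real (m - 2)))"
      using js J(1) unfolding n_def by blast
  qed
qed

section \<open>Volumes of simplices\<close>

text \<open>
  The residual of an orthogonal projection realises the distance to the subspace.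
\<close>

lemma obtain_orthogonal_residual:
  fixes A :: "'a::euclidean_space set"
  assumes "subspace A"
  obtains r where "u - r \<in> A" "\<And>a. a \<in> A \<Longrightarrow> orthogonal a r" "norm r \<le> infdist u A"
proof -
  obtain P where P: "linear P" "\<And>x. x - P x \<in> A" "\<And>a x. a \<in> A \<Longrightarrow> orthogonal a (P x)"
      "\<And>x. norm (P x) \<le> norm x"
    using obtain_orthogonal_complement_projection[OF assms] by metis
  have sA: "span A = A" using assms by (simp add: span_eq_iff)
  obtain x where x: "x \<in> A" "infdist u A = norm (u - x)"
    using infdist_span_attained[of A u] sA by auto
  have "x - (x - P x) \<in> A" using subspace_diff[OF assms x(1) P(2)] .
  then have "P x = 0" using P(3)[of "P x" x] by (simp add: orthogonal_self)
  then have "norm (P u) \<le> infdist u A"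
    using P(4)[of "u - x"] linear_diff[OF P(1), of u x] x(2) by simp
  then show ?thesis using that[of "P u"] P(2,3) by blast
qed

text \<open>
  Gram-Schmidt along the list: subtracting from each row its projection to the span of the later
  rows does not change the determinant, and it leaves orthogonal rows whose norms are the heights
  in the definition of the volume.
\<close>

lemma abs_det_le_parvol:
  fixes u :: "'n::finite \<Rightarrow> real^'n"
  assumes "distinct is" "set is = UNIV"
  shows "\<bar>det (\<chi> i. u i)\<bar> \<le> parvol (map u is)"
proof -
  define later where "later i = set (tl (dropWhile (\<lambda>x. x \<noteq> i) is))" for i
  have later: "later i = set post" if "is = pre @ i # post" for pre i post
  proof -
    have "dropWhile (\<lambda>x. x \<noteq> i) (pre @ i # post) = i # post"
      using assms(1) that by (subst dropWhile_append2) auto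
    then show ?thesis by (simp add: later_def that)
  qed
  have "\<exists>r. u i - r \<in> span (u ` later i) \<and> (\<forall>a\<in>span (u ` later i). orthogonal a r) \<and>
      norm r \<le> infdist (u i) (span (u ` later i))" for i
    using obtain_orthogonal_residual[OF subspace_span] by metis
  then obtain r where r: "\<And>i. u i - r i \<in> span (u ` later i)"
      "\<And>i a. a \<in> span (u ` later i) \<Longrightarrow> orthogonal a (r i)"
      "\<And>i. norm (r i) \<le> infdist (u i) (span (u ` later i))"
    by metis
  \<comment> \<open>Rows are replaced from the front, so that each step only uses later rows that are still unchanged.\<close>
  have "det (\<chi> i. if i \<in> set xs then r i else u i) = det (\<chi> i. u i)" if "is = xs @ ys" for xs ys
    using that
  proof (induction xs arbitrary: ys rule: rev_induct)
    case (snoc k xs)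
    let ?A = "\<chi> i. if i \<in> set xs then r i else u i"
    have k: "k \<notin> set xs" and ys: "set ys \<inter> set xs = {}" "k \<notin> set ys"
      using assms(1) snoc.prems by auto
    have "later k = set ys" using later[of xs k ys] snoc.prems by simp
    then have "u k - r k \<in> span (u ` set ys)" using r(1)[of k] by simp
    moreover have "u ` set ys \<subseteq> {row j ?A |j. j \<noteq> k}"
    proof
      fix x assume "x \<in> u ` set ys"
      then obtain j where "j \<in> set ys" "x = u j" by blast
      then have "x = row j ?A" "j \<noteq> k" using ys by (auto simp: row_def vec_eq_iff)
      then show "x \<in> {row j ?A |j. j \<noteq> k}" by blast
    qed
    ultimately have "u k - r k \<in> span {row j ?A |j. j \<noteq> k}"
      using span_mono by blast
    then have "- (u k - r k) \<in> span {row j ?A |j. j \<noteq> k}" by (rule span_neg)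
    then have "r k - u k \<in> vec.span {row j ?A |j. j \<noteq> k}" by (simp add: span_vec_eq)
    then have "det (\<chi> i. if i = k then row k ?A + (r k - u k) else row i ?A) = det ?A"
      by (rule det_row_span)
    moreover have "(\<chi> i. if i = k then row k ?A + (r k - u k) else row i ?A)
        = (\<chi> i. if i \<in> set (xs @ [k]) then r i else u i)"
      using k by (auto simp: vec_eq_iff row_def)
    ultimately show ?case using snoc.IH[of "k # ys"] snoc.prems by simp
  qed simp
  from this[of "is" "[]"] have det_r: "det (\<chi> i. r i) = det (\<chi> i. u i)"
    using assms(2) by simp
  have orth_later: "r i \<bullet> r j = 0" if split: "is = pre @ i # post" and j: "j \<in> set post" for pre i post j
  proof -
    obtain p q where pq: "post = p @ j # q" using split_list[OF j] by blast
    have "later j \<subseteq> set post" using later[of "pre @ i # p" j q] split pq by auto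
    then have "u j - r j \<in> span (u ` set post)" using r(1)[of j] span_mono[of "u ` later j" "u ` set post"] by blast
    moreover have "u j \<in> span (u ` set post)" using j by (simp add: span_base)
    ultimately have "u j - (u j - r j) \<in> span (u ` set post)"
      by (rule span_diff[rotated])
    then have "r j \<in> span (u ` later i)" using later[OF split] by simp
    then show ?thesis using r(2)[of "r j" i] by (simp add: orthogonal_def inner_commute)
  qed
  have orth: "r i \<bullet> r j = 0" if "i \<noteq> j" for i j
  proof -
    obtain pre post where split: "is = pre @ i # post" using assms(2) split_list[of i "is"] by auto
    have "j \<in> set post \<or> j \<in> set pre" using assms(2) split that by (metis UNIV_I Un_iff set_append set_ConsD)
    then show ?thesis
    proof
      assume "j \<in> set pre"
      then obtain p q where "pre = p @ j # q" using split_list by metis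
      then show ?thesis using orth_later[of p j "q @ i # post" i] split by (simp add: inner_commute)
    qed (rule orth_later[OF split])
  qed
  let ?R = "\<chi> i. r i"
  have RR: "(?R ** transpose ?R) $ i $ j = r i \<bullet> r j" for i j
    by (simp add: matrix_matrix_mult_def transpose_def inner_vec_def)
  have "det ?R ^ 2 = det (?R ** transpose ?R)"
    by (simp add: det_mul det_transpose power2_eq_square)
  also have "\<dots> = (\<Prod>i\<in>UNIV. r i \<bullet> r i)"
    by (subst det_diagonal) (simp_all add: RR orth)
  also have "\<dots> = (\<Prod>i\<in>UNIV. norm (r i)) ^ 2"
    by (simp add: prod_power_distrib power2_norm_eq_inner flip: prod.distrib)
  finally have "\<bar>det ?R\<bar> = (\<Prod>i\<in>UNIV. norm (r i))"
    using power2_eq_iff_nonneg[of "\<bar>det ?R\<bar>" "\<Prod>i\<in>UNIV. norm (r i)"] by (simp add: prod_nonneg)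
  also have "\<dots> = (\<Prod>i\<leftarrow>is. norm (r i))"
    using prod.distinct_set_conv_list[OF assms(1), of "\<lambda>i. norm (r i)"] assms(2) by simp
  also have "\<dots> \<le> parvol (map u is)"
  proof -
    have "(\<Prod>i\<leftarrow>ys. norm (r i)) \<le> parvol (map u ys)" if "is = xs @ ys" for xs ys
      using that
    proof (induction ys arbitrary: xs)
      case (Cons k ys)
      have "norm (r k) \<le> infdist (u k) (span (set (map u ys)))"
        using r(3)[of k] later[OF Cons.prems] by simp
      moreover have "(\<Prod>i\<leftarrow>ys. norm (r i)) \<le> parvol (map u ys)"
        using Cons.IH[of "xs @ [k]"] Cons.prems by simp
      moreover have "0 \<le> (\<Prod>i\<leftarrow>ys. norm (r i))" by (induction ys) auto
      ultimately show ?case by (auto intro!: mult_mono infdist_nonneg)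
    qed simp
    from this[of "[]" "is"] show ?thesis by simp
  qed
  finally show ?thesis by (simp add: det_r)
qed

lemma ex_map_eq:
  assumes "distinct is" "length is = length ys"
  shows "\<exists>u. map u is = ys"
proof -
  have "map (\<lambda>i. the (map_of (zip is ys) i)) is = ys"
    using assms by (intro nth_equalityI) (auto simp: map_of_zip_nth)
  then show ?thesis by blast
qed

text \<open>
  The simplex lies in the parallelotope spanned by its edges at \<open>a\<close>, an affine image of the unit cube.
\<close>

lemma measure_simplex_le_parvol:
  fixes a :: "(real, 'd::{finite,wellorder}) vec"
  assumes len: "length xs = CARD('d)"
  shows "measure lborel (convex hull (insert a (set xs))) \<le> parvol (map (\<lambda>x. x - a) xs)"
proof -
  obtain "is" :: "'d list" where is1: "set is = UNIV" "distinct is"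
    using finite_distinct_list[of "UNIV :: 'd set"] by auto
  then have "length is = CARD('d)" using distinct_card by fastforce
  then obtain u where u: "map u is = map (\<lambda>x. x - a) xs"
    using ex_map_eq[OF is1(2), of "map (\<lambda>x. x - a) xs"] len by auto
  define f where "f t = (\<Sum>i\<in>UNIV. t $ i *\<^sub>R u i)" for t :: "(real, 'd) vec"
  have lin: "linear f"
    unfolding f_def by (rule linearI) (simp_all add: scaleR_add_left sum.distrib scaleR_sum_right)
  have f_axis: "f (axis i 1) = u i" for i
  proof -
    have "f (axis i 1) = (\<Sum>j\<in>UNIV. if j = i then u j else 0)"
      unfolding f_def by (intro sum.cong) (auto simp: axis_def)
    then show ?thesis by simp
  qed
  have "matrix f = transpose (\<chi> i. u i)"
    by (simp add: matrix_def transpose_def f_axis)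
  then have det: "\<bar>det (matrix f)\<bar> \<le> parvol (map (\<lambda>x. x - a) xs)"
    using abs_det_le_parvol[OF is1(2,1), of u] u by (simp add: det_transpose)
  let ?B = "cbox 0 One :: (real, 'd) vec set"
  let ?K = "(+) a ` f ` ?B"
  have sub: "convex hull (insert a (set xs)) \<subseteq> ?K"
  proof (rule hull_minimal)
    show "convex ?K"
      using convex_translation[OF convex_linear_image[OF lin convex_box(1)]] by blast
    show "insert a (set xs) \<subseteq> ?K"
    proof
      fix x assume "x \<in> insert a (set xs)"
      then consider "x = a" | "x \<in> set xs" by blast
      then show "x \<in> ?K"
      proof cases
        case 1
        have "x = a + f 0" using 1 linear_0[OF lin] by simp
        then show ?thesis by (auto simp: mem_box intro!: image_eqI)
      next
        case 2
        then have "x - a \<in> set (map u is)" using u by simp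
        then obtain i where "x - a = u i" by auto
        then have "x = a + f (axis i 1)" by (simp add: f_axis algebra_simps)
        moreover have "axis i 1 \<in> ?B"
          using axis_in_Basis_iff[of i "1::real"] by (auto simp: mem_box inner_Basis)
        ultimately show ?thesis by blast
      qed
    qed
  qed
  have meas: "f ` ?B \<in> lmeasurable" by (rule measurable_linear_image[OF lin]) simp
  have cH: "compact (convex hull (insert a (set xs)))" by (simp add: finite_imp_compact_convex_hull)
  have "measure lborel (convex hull (insert a (set xs))) = measure lebesgue (convex hull (insert a (set xs)))"
    using cH by (simp add: borel_compact)
  also have "\<dots> \<le> measure lebesgue ?K"
    by (rule measure_mono_fmeasurable[OF sub])
       (use cH meas lmeasurable_compact measurable_translation in \<open>auto simp: fmeasurableD\<close>)
  also have "\<dots> = measure lebesgue (f ` ?B)" by (rule measure_translation)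
  also have "\<dots> = \<bar>det (matrix f)\<bar>"
    by (subst measure_linear_image[OF lin]) auto
  finally show ?thesis using det by simp
qed

text \<open>
  Back from the projective to the affine setting: the map \<open>(s, z) \<mapsto> z - s a\<close> sends \<open>(1, x)\<close> to
  \<open>x - a\<close> and kills \<open>(1, a)\<close>, so heights over a base that contains \<open>(1, a)\<close> grow by at most the
  norm of this map.
\<close>

lemma parvol_differences_le:
  fixes a :: "'a::euclidean_space"
  shows "parvol (map (\<lambda>x. x - a) xs)
    \<le> (1 + norm a) ^ length xs * parvol (map (\<lambda>x. (1::real, x)) (xs @ [a]))"
proof (induction xs)
  case Nil
  have "1 \<le> norm (1::real, a)" using norm_fst_le[of "1::real" a] by simp
  also have "\<dots> = parvol [(1::real, a)]"
    by (simp add: infdist_def dist_norm)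
  finally show ?case by simp
next
  case (Cons x xs)
  define L where "L p = snd p - fst p *\<^sub>R a" for p :: "real \<times> 'a"
  have L: "linear L" unfolding L_def by (rule linearI) (simp_all add: algebra_simps)
  have L_bound: "norm (L p) \<le> (1 + norm a) * norm p" for p
  proof -
    have "norm (L p) \<le> norm (snd p) + \<bar>fst p\<bar> * norm a"
      unfolding L_def using norm_triangle_ineq4[of "snd p" "fst p *\<^sub>R a"] by simp
    also have "\<dots> \<le> norm p + norm p * norm a"
      using norm_fst_le[of "fst p" "snd p"] norm_snd_le[of "snd p" "fst p"] by (intro add_mono mult_right_mono) auto
    finally show ?thesis by (simp add: algebra_simps)
  qed
  let ?V = "set (map (\<lambda>x. (1::real, x)) (xs @ [a]))"
  obtain p where p: "p \<in> span ?V" "infdist (1::real, x) (span ?V) = norm ((1, x) - p)"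
    by (rule infdist_span_attained)
  have "L ` ?V \<subseteq> insert 0 (set (map (\<lambda>x. x - a) xs))" by (auto simp: L_def)
  then have "L p \<in> span (insert 0 (set (map (\<lambda>x. x - a) xs)))"
    using p(1) linear_span_image[OF L, of ?V] span_mono by blast
  then have "L p \<in> span (set (map (\<lambda>x. x - a) xs))" by (simp add: span_insert_0)
  then have "infdist (x - a) (span (set (map (\<lambda>x. x - a) xs))) \<le> norm ((x - a) - L p)"
    by (rule infdist_span_le)
  also have "(x - a) - L p = L ((1, x) - p)" by (simp add: L_def algebra_simps)
  also have "norm \<dots> \<le> (1 + norm a) * infdist (1::real, x) (span ?V)" using L_bound p(2) by simp
  finally have "infdist (x - a) (span (set (map (\<lambda>x. x - a) xs))) * parvol (map (\<lambda>x. x - a) xs)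
      \<le> ((1 + norm a) * infdist (1::real, x) (span ?V)) *
         ((1 + norm a) ^ length xs * parvol (map (\<lambda>x. (1::real, x)) (xs @ [a])))"
    by (intro mult_mono Cons.IH) (auto intro!: mult_nonneg_nonneg parvol_nonneg infdist_nonneg)
  then show ?case by (simp add: mult_ac)
qed

text \<open>
  Points \<open>x\<close> of the cube become vectors \<open>(1, x)\<close>, scaled into the unit ball of a space of
  dimension \<open>d + 1\<close>.
\<close>

lemma heilbronn_le_of_small_volume:
  assumes sv: "small_volume TYPE(real \<times> (real, 'd::{finite,wellorder}) vec) k k e"
    and k: "k = CARD('d) + 1"
  shows "\<exists>C>0. \<forall>n\<ge>k. heilbronn TYPE('d) k n \<le> C * real n powr (- e)"
proof -
  obtain C where C: "C > 0" "\<And>(S::(real \<times> (real, 'd) vec) set) (I::nat set) v. \<lbrakk>subspace S; dim S = k; finite I;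
      k \<le> card I; \<forall>i\<in>I. v i \<in> S \<and> norm (v i) \<le> 1\<rbrakk> \<Longrightarrow>
      \<exists>is. distinct is \<and> set is \<subseteq> I \<and> length is = k \<and> parvol (map v is) \<le> C * real (card I) powr (- e)"
    using sv unfolding small_volume_def by metis
  define \<rho> where "\<rho> = 1 + real CARD('d)"
  have \<rho>: "0 < \<rho>" by (simp add: \<rho>_def)
  define C' where "C' = \<rho> ^ CARD('d) * (\<rho> ^ k * C)"
  have C': "0 < C'" using C(1) \<rho> by (simp add: C'_def)
  have "heilbronn TYPE('d) k n \<le> C' * real n powr (- e)" if n: "k \<le> n" for n
    unfolding heilbronn_def
  proof (rule cInf_lower)
    show "bdd_below {\<Delta>. \<Delta> > 0 \<and> (\<forall>P :: (real, 'd) vec set. P \<subseteq> {x. \<forall>i. x $ i \<in> {0..1}} \<and> finite P \<and> card P = n \<longrightarrow>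
        (\<exists>Q\<subseteq>P. card Q = k \<and> flat_volume (k - 1) (convex hull Q) \<le> \<Delta>))}"
      by (rule bdd_belowI[of _ 0]) auto
    have "\<exists>Q\<subseteq>P. card Q = k \<and> flat_volume (k - 1) (convex hull Q) \<le> C' * real n powr (- e)"
      if P: "P \<subseteq> {x. \<forall>i. x $ i \<in> {0..1}}" "finite P" "card P = n" for P :: "(real, 'd) vec set"
    proof -
      obtain p where p: "bij_betw p {0..<n} P" using ex_bij_betw_nat_finite[OF P(2)] P(3) by blast
      have norm_p: "norm (p i) \<le> real CARD('d)" if "i < n" for i
      proof -
        have "p i \<in> P" using p that by (auto simp: bij_betw_def)
        then have "\<bar>p i $ j\<bar> \<le> 1" for j using P(1) by (auto simp: subset_iff)
        then have "(\<Sum>j\<in>UNIV. \<bar>p i $ j\<bar>) \<le> (\<Sum>j\<in>(UNIV::'d set). 1)" by (intro sum_mono)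
        then show ?thesis using norm_le_l1_cart[of "p i"] by simp
      qed
      define h where "h i = (1::real, p i)" for i
      have norm_h: "norm (h i) \<le> \<rho>" if "i < n" for i
        using norm_Pair_le[of "1::real" "p i"] norm_p[OF that] by (simp add: h_def \<rho>_def)
      have "\<forall>i\<in>{0..<n}. (1 / \<rho>) *\<^sub>R h i \<in> UNIV \<and> norm ((1 / \<rho>) *\<^sub>R h i) \<le> 1"
        using norm_h \<rho> by (auto simp: divide_le_eq)
      moreover have "dim (UNIV :: (real \<times> (real, 'd) vec) set) = k" by (simp add: k)
      ultimately obtain "is" where is1: "distinct is" "set is \<subseteq> {0..<n}" "length is = k"
          and vol: "parvol (map (\<lambda>i. (1 / \<rho>) *\<^sub>R h i) is) \<le> C * real n powr (- e)"
        using C(2)[of UNIV "{0..<n}" "\<lambda>i. (1 / \<rho>) *\<^sub>R h i"] n by auto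
      obtain js j where js: "is = js @ [j]" using is1(3) k by (cases "is" rule: rev_cases) auto
      define Q where "Q = p ` set is"
      have "inj_on p (set is)" using p is1(2) by (auto simp: bij_betw_def intro: inj_on_subset)
      then have Q: "card Q = k" "Q \<subseteq> P"
        using is1 distinct_card[OF is1(1)] p by (auto simp: Q_def card_image bij_betw_def)
      have jn: "j < n" using is1(2) js by auto
      have Qeq: "Q = insert (p j) (set (map p js))" by (auto simp: Q_def js)
      have "map (\<lambda>x. (1::real, x)) (map p js @ [p j]) = map h is" by (simp add: js h_def)
      then have diff: "parvol (map (\<lambda>x. x - p j) (map p js)) \<le> (1 + norm (p j)) ^ length js * parvol (map h is)"
        using parvol_differences_le[of "p j" "map p js"] by simp
      have "(\<Prod>i\<leftarrow>is. \<bar>1 / \<rho>\<bar>) = (1 / \<rho>) ^ k"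
        using \<rho> is1(3) by (simp add: map_replicate_const)
      then have "parvol (map (\<lambda>i. (1 / \<rho>) *\<^sub>R h i) is) = (1 / \<rho>) ^ k * parvol (map h is)"
        using parvol_scaleR[of "\<lambda>i. 1 / \<rho>" h "is"] by simp
      then have "parvol (map h is) = \<rho> ^ k * parvol (map (\<lambda>i. (1 / \<rho>) *\<^sub>R h i) is)"
        using \<rho> by (simp add: field_simps)
      then have "parvol (map h is) \<le> \<rho> ^ k * (C * real n powr (- e))"
        using vol \<rho> by simp
      moreover have "(1 + norm (p j)) ^ length js \<le> \<rho> ^ CARD('d)"
        using norm_p[OF jn] is1(3) js k by (auto simp: \<rho>_def intro!: power_mono)
      ultimately have "(1 + norm (p j)) ^ length js * parvol (map h is)
          \<le> \<rho> ^ CARD('d) * (\<rho> ^ k * (C * real n powr (- e)))"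
        using \<rho> by (intro mult_mono parvol_nonneg) auto
      then have "parvol (map (\<lambda>x. x - p j) (map p js)) \<le> C' * real n powr (- e)"
        using diff by (simp add: C'_def mult_ac)
      moreover have "measure lborel (convex hull Q) \<le> parvol (map (\<lambda>x. x - p j) (map p js))"
        unfolding Qeq using is1(3) js k by (intro measure_simplex_le_parvol) simp
      moreover have "flat_volume (k - 1) (convex hull Q) = measure lborel (convex hull Q)"
        using flat_volume_full[of "convex hull Q"] by (simp add: k Qeq finite_imp_compact_convex_hull)
      ultimately show ?thesis using Q by (intro exI[of _ Q]) simp
    qed
    then show "C' * real n powr (- e) \<in> {\<Delta>. \<Delta> > 0 \<and> (\<forall>P :: (real, 'd) vec set. P \<subseteq> {x. \<forall>i. x $ i \<in> {0..1}} \<and> finite P \<and> card P = n \<longrightarrow>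
        (\<exists>Q\<subseteq>P. card Q = k \<and> flat_volume (k - 1) (convex hull Q) \<le> \<Delta>))}"
      using C' n k by simp
  qed
  then show ?thesis using C' by blast
qed

section \<open>The exponents\<close>

lemma small_volume_dim_2: "small_volume TYPE('a::euclidean_space) 2 2 1"
  using small_volume_cluster[of 2 2] by simp

text \<open>
  In each dimension the first vectors are selected by one of the two cluster lemmas and the
  remaining ones in the complement of their span. The exponents are sums accordingly:
  \<open>4/3 = 1/3 + 1\<close>, \<open>3/2 = 2/4 + 1\<close>, \<open>33/20 = (2/5 + 1/4) + 1\<close>, \<open>17/10 = (3/6 + 1/5) + 1\<close>,
  \<open>251/140 = 1/7 + 33/20\<close> and \<open>19/10 = 2/8 + 33/20\<close>. Dimensions 7 and 8 leave some room:
  \<open>17/10 > 1.676\<close> and \<open>251/140 > 1.792\<close>.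
\<close>

lemma small_volume_dim_4: "small_volume TYPE('a::euclidean_space) 4 4 (4/3)"
  using small_volume_compose[OF small_volume_cluster[of 4 2], of 2 1] small_volume_dim_2 by simp

lemma small_volume_dim_5: "small_volume TYPE('a::euclidean_space) 5 5 (3/2)"
  using small_volume_compose[OF small_volume_cluster[of 5 3], of 2 1] small_volume_dim_2 by simp

lemma small_volume_dim_6: "small_volume TYPE('a::euclidean_space) 6 6 (33/20)"
  using small_volume_compose[OF small_volume_two_clusters[of 6 2], of 2 1] small_volume_dim_2 by simp

lemma small_volume_dim_7: "small_volume TYPE('a::euclidean_space) 7 7 (17/10)"
  using small_volume_compose[OF small_volume_two_clusters[of 7 3], of 2 1] small_volume_dim_2 by simp

lemma small_volume_dim_8: "small_volume TYPE('a::euclidean_space) 8 8 (251/140)"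
  using small_volume_compose[OF small_volume_cluster[of 8 2], of 6 "33/20"] small_volume_dim_6 by simp

lemma small_volume_dim_9: "small_volume TYPE('a::euclidean_space) 9 9 (19/10)"
  using small_volume_compose[OF small_volume_cluster[of 9 3], of 6 "33/20"] small_volume_dim_6 by simp

lemma le_mult_powr_weaken:
  fixes C D e f x :: real
  assumes "x \<le> C * real n powr (- e)" "0 < C" "C \<le> D" "f \<le> e" "1 \<le> n"
  shows "x \<le> D * real n powr (- f)"
proof -
  have "real n powr (- e) \<le> real n powr (- f)" using assms by (intro powr_mono) auto
  then have "C * real n powr (- e) \<le> D * real n powr (- f)" using assms by (intro mult_mono) auto
  then show ?thesis using assms(1) by simp
qed

theorem corollary1p2:
  shows "\<exists>C::real. C > 0 \<and>
    (\<forall>n\<ge>4. heilbronn TYPE(3) 4 n \<le> C * real n powr (- (4/3))) \<and>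
    (\<forall>n\<ge>5. heilbronn TYPE(4) 5 n \<le> C * real n powr (- (3/2))) \<and>
    (\<forall>n\<ge>6. heilbronn TYPE(5) 6 n \<le> C * real n powr (- (33/20))) \<and>
    (\<forall>n\<ge>7. heilbronn TYPE(6) 7 n \<le> C * real n powr (- 1.676)) \<and>
    (\<forall>n\<ge>8. heilbronn TYPE(7) 8 n \<le> C * real n powr (- 1.792)) \<and>
    (\<forall>n\<ge>9. heilbronn TYPE(8) 9 n \<le> C * real n powr (- (19/10)))"
proof -
  obtain C3 where C3: "C3 > 0" "\<And>n. n \<ge> 4 \<Longrightarrow> heilbronn TYPE(3) 4 n \<le> C3 * real n powr (- (4/3))"
    using heilbronn_le_of_small_volume[where 'd=3, OF small_volume_dim_4] by auto
  obtain C4 where C4: "C4 > 0" "\<And>n. n \<ge> 5 \<Longrightarrow> heilbronn TYPE(4) 5 n \<le> C4 * real n powr (- (3/2))"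
    using heilbronn_le_of_small_volume[where 'd=4, OF small_volume_dim_5] by auto
  obtain C5 where C5: "C5 > 0" "\<And>n. n \<ge> 6 \<Longrightarrow> heilbronn TYPE(5) 6 n \<le> C5 * real n powr (- (33/20))"
    using heilbronn_le_of_small_volume[where 'd=5, OF small_volume_dim_6] by auto
  obtain C6 where C6: "C6 > 0" "\<And>n. n \<ge> 7 \<Longrightarrow> heilbronn TYPE(6) 7 n \<le> C6 * real n powr (- (17/10))"
    using heilbronn_le_of_small_volume[where 'd=6, OF small_volume_dim_7] by auto
  obtain C7 where C7: "C7 > 0" "\<And>n. n \<ge> 8 \<Longrightarrow> heilbronn TYPE(7) 8 n \<le> C7 * real n powr (- (251/140))"
    using heilbronn_le_of_small_volume[where 'd=7, OF small_volume_dim_8] by auto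
  obtain C8 where C8: "C8 > 0" "\<And>n. n \<ge> 9 \<Longrightarrow> heilbronn TYPE(8) 9 n \<le> C8 * real n powr (- (19/10))"
    using heilbronn_le_of_small_volume[where 'd=8, OF small_volume_dim_9] by auto
  show ?thesis
  proof (intro exI[of _ "C3 + C4 + C5 + C6 + C7 + C8"] conjI allI impI)
    show "0 < C3 + C4 + C5 + C6 + C7 + C8" using C3 C4 C5 C6 C7 C8 by simp
  qed (rule le_mult_powr_weaken[OF C3(2)] le_mult_powr_weaken[OF C4(2)] le_mult_powr_weaken[OF C5(2)]
      le_mult_powr_weaken[OF C6(2)] le_mult_powr_weaken[OF C7(2)] le_mult_powr_weaken[OF C8(2)];
      use C3(1) C4(1) C5(1) C6(1) C7(1) C8(1) in simp)+
qed

end
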